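(* Let $\Omega\subset\mathbb{R}^2$ be an open bounded convex set and let $\phi$ be a metric integrand depending only on the second variable such that $B_\phi(0,1)$ is not strictly convex. Then there exists a boundary datum $f\in C(\partial\Omega)$ for which there exist solutions $u_1,u_2$ to the anisotropic least gradient problem $$\min\Big\{\int_\Omega\phi(Du):\ u\in BV(\Omega),\ u|_{\partial\Omega}=f\Big\}$$ such that $u_1\notin W^{1,1}(\Omega)$ and $u_2\notin SBV(\Omega)$.
   Context: A metric integrand depending only on the second variable is a convex function $\phi:\mathbb{R}^2\to[0,\infty)$ with $\phi(t\xi)=|t|\phi(\xi)$ for $t\in\mathbb{R}$ and $\lambda|\xi|\le\phi(\xi)\le\Gamma|\xi|$ for some constants $\lambda,\Gamma>0$ (i.e. a norm). $B_\phi(0,1)$ is its unit ball; not strictly convex means that $\partial B_\phi(0,1)$ contains a nondegenerate line segment. With $\phi^0(\xi^* )=\sup\{\langle\xi^*,\xi\rangle:\phi(\xi)\le1\}$, the $\phi$-total variation is $$\int_\Omega\phi(Du)=\int_\Omega|Du|_\phi=\sup\Big\{\int_\Omega u\,\mathrm{div}\,\mathbf{z}\,dx:\ \mathbf{z}\in C_c^1(\Omega;\mathbb{R}^2),\ \phi^0(\mathbf{z}(x))\le1\ \text{a.e.}\Big\}.$$ A function $u\in BV(\Omega)$ is of $\phi$-least gradient if $\int_\Omega|Du|_\phi\le\int_\Omega|D(u+v)|_\phi$ for every compactly supported $v\in BV(\Omega)$ (equivalently here, for every $v\in BV(\Omega)$ with zero trace). A solution to the problem is a function $u$ of $\phi$-least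 gradient with trace $Tu=f$. $SBV(\Omega)$ is the space of special functions of bounded variation (those $BV$ functions whose derivative has no Cantor part). *)

theory Defs
  imports "HOL-Analysis.Analysis"
begin

type_synonym plane = "real^2"

definition metric_integrand :: "(plane \<Rightarrow> real) \<Rightarrow> bool" where
  "metric_integrand \<phi> \<longleftrightarrow>
     convex_on UNIV \<phi> \<and>
     (\<forall>\<xi>. 0 \<le> \<phi> \<xi>) \<and>
     (\<forall>t \<xi>. \<phi> (t *\<^sub>R \<xi>) = \<bar>t\<bar> * \<phi> \<xi>) \<and>
     (\<exists>l>0. \<exists>\<Gamma>>0. \<forall>\<xi>. l * norm \<xi> \<le> \<phi> \<xi> \<and> \<phi> \<xi> \<le> \<Gamma> * norm \<xi>)"

definition integrand_ball :: "(plane \<Rightarrow> real) \<Rightarrow> plane set" where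
  "integrand_ball \<phi> = {\<xi>. \<phi> \<xi> \<le> 1}"

definition strictly_convex_ball :: "(plane \<Rightarrow> real) \<Rightarrow> bool" where
  "strictly_convex_ball \<phi> \<longleftrightarrow>
     \<not> (\<exists>a b. a \<noteq> b \<and> closed_segment a b \<subseteq> frontier (integrand_ball \<phi>))"

definition dual_integrand :: "(plane \<Rightarrow> real) \<Rightarrow> plane \<Rightarrow> real" where
  "dual_integrand \<phi> \<xi>' = Sup {\<xi>' \<bullet> \<xi> | \<xi>. \<phi> \<xi> \<le> 1}"

(* Functions on Omega are represented by functions on the whole plane whose values outside
   Omega are irrelevant; test functions, however, are extended by zero. *)
definition Cc1 :: "plane set \<Rightarrow> (plane \<Rightarrow> 'b::real_normed_vector) set" where
  "Cc1 \<Omega> = {z. (\<forall>x. z differentiable (at x)) \<and>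
               (\<forall>v. continuous_on UNIV (\<lambda>x. frechet_derivative z (at x) v)) \<and>
               (\<exists>K. compact K \<and> K \<subseteq> \<Omega> \<and> (\<forall>x. x \<notin> K \<longrightarrow> z x = 0))}"

definition divergence :: "(plane \<Rightarrow> plane) \<Rightarrow> plane \<Rightarrow> real" where
  "divergence z x = (\<Sum>b\<in>Basis. frechet_derivative z (at x) b \<bullet> b)"

definition total_variation :: "plane set \<Rightarrow> (plane \<Rightarrow> real) \<Rightarrow> ereal" where
  "total_variation \<Omega> u =
     (SUP z \<in> {z \<in> Cc1 \<Omega>. \<forall>x. norm (z x) \<le> 1}.
        ereal (\<integral>x. u x * divergence z x \<partial>lebesgue_on \<Omega>))"

definition phi_variation :: "plane set \<Rightarrow> (plane \<Rightarrow> real) \<Rightarrow> (plane \<Rightarrow> real) \<Rightarrow> ereal" where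
  "phi_variation \<Omega> \<phi> u =
     (SUP z \<in> {z \<in> Cc1 \<Omega>. AE x in lebesgue_on \<Omega>. dual_integrand \<phi> (z x) \<le> 1}.
        ereal (\<integral>x. u x * divergence z x \<partial>lebesgue_on \<Omega>))"

definition BV :: "plane set \<Rightarrow> (plane \<Rightarrow> real) set" where
  "BV \<Omega> = {u. integrable (lebesgue_on \<Omega>) u \<and> total_variation \<Omega> u < \<infinity>}"

definition W11 :: "plane set \<Rightarrow> (plane \<Rightarrow> real) set" where
  "W11 \<Omega> = {u. integrable (lebesgue_on \<Omega>) u \<and>
     (\<exists>g :: plane \<Rightarrow> plane. integrable (lebesgue_on \<Omega>) g \<and>
        (\<forall>\<psi> \<in> Cc1 \<Omega>. \<forall>b\<in>Basis.
           (\<integral>x. u x * frechet_derivative \<psi> (at x) b \<partial>lebesgue_on \<Omega>)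
             = - (\<integral>x. (g x \<bullet> b) * \<psi> x \<partial>lebesgue_on \<Omega>)))}"

(* c is the L1-averaged one-sided (from Omega) limit of u at x; x may lie in Omega or on
   its boundary. *)
definition approx_limit :: "plane set \<Rightarrow> (plane \<Rightarrow> real) \<Rightarrow> plane \<Rightarrow> real \<Rightarrow> bool" where
  "approx_limit \<Omega> u x c \<longleftrightarrow>
     ((\<lambda>r. (\<integral>y. \<bar>u y - c\<bar> \<partial>lebesgue_on (ball x r \<inter> \<Omega>)) / measure lebesgue (ball x r \<inter> \<Omega>))
        \<longlongrightarrow> 0) (at_right 0)"

definition approx_discontinuity_set :: "plane set \<Rightarrow> (plane \<Rightarrow> real) \<Rightarrow> plane set" where
  "approx_discontinuity_set \<Omega> u = {x \<in> \<Omega>. \<not> (\<exists>c. approx_limit \<Omega> u x c)}"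

(* One-dimensional Hausdorff outer measure; its normalising constant is 1. *)
definition hausdorff1 :: "plane set \<Rightarrow> ennreal" where
  "hausdorff1 A =
     (SUP \<delta> \<in> {0<..}.
        INF C \<in> {C :: nat \<Rightarrow> plane set. A \<subseteq> (\<Union>n. C n) \<and> (\<forall>n. bounded (C n) \<and> diameter (C n) \<le> \<delta>)}.
          (\<Sum>n. ennreal (diameter (C n))))"

(* Tu = f. On a bounded Lipschitz domain (in particular a bounded convex one) the trace of a
   BV function is determined by this relation. *)
definition has_trace :: "plane set \<Rightarrow> (plane \<Rightarrow> real) \<Rightarrow> (plane \<Rightarrow> real) \<Rightarrow> bool" where
  "has_trace \<Omega> u f \<longleftrightarrow> hausdorff1 {x \<in> frontier \<Omega>. \<not> approx_limit \<Omega> u x (f x)} = 0"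

(* Du = sigma mu in polar form: mu = |Du| is a finite Borel measure concentrated on Omega and
   sigma = dDu/d|Du| is a unit field. *)
definition BV_derivative ::
    "plane set \<Rightarrow> (plane \<Rightarrow> real) \<Rightarrow> plane measure \<Rightarrow> (plane \<Rightarrow> plane) \<Rightarrow> bool" where
  "BV_derivative \<Omega> u \<mu> \<sigma> \<longleftrightarrow>
     sets \<mu> = sets borel \<and> finite_measure \<mu> \<and> emeasure \<mu> (- \<Omega>) = 0 \<and>
     \<sigma> \<in> borel_measurable borel \<and> (AE x in \<mu>. norm (\<sigma> x) = 1) \<and>
     (\<forall>z \<in> Cc1 \<Omega>. (\<integral>x. u x * divergence z x \<partial>lebesgue_on \<Omega>) = - (\<integral>x. z x \<bullet> \<sigma> x \<partial>\<mu>))"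

(* Lebesgue decomposition: the part of mu that is singular with respect to Lebesgue measure
   is the restriction of mu to N. *)
definition singular_carrier :: "plane measure \<Rightarrow> plane set \<Rightarrow> bool" where
  "singular_carrier \<mu> N \<longleftrightarrow>
     N \<in> null_sets lborel \<and> absolutely_continuous lborel (density \<mu> (indicator (- N)))"

(* The Cantor part D^c u is the singular part of Du = sigma mu restricted to the complement
   of the approximate discontinuity set. *)
definition cantor_part ::
    "plane set \<Rightarrow> (plane \<Rightarrow> real) \<Rightarrow> plane measure \<Rightarrow> (plane \<Rightarrow> plane) \<Rightarrow> plane set \<Rightarrow> plane set \<Rightarrow> plane" where
  "cantor_part \<Omega> u \<mu> \<sigma> N B =
     (LINT x : B \<inter> N \<inter> (\<Omega> - approx_discontinuity_set \<Omega> u) | \<mu>. \<sigma> x)"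

(* mu is unique, sigma is unique mu-a.e. and N is unique up to mu-null sets, so that it does
   not matter which representation of Du is used. *)
definition SBV :: "plane set \<Rightarrow> (plane \<Rightarrow> real) set" where
  "SBV \<Omega> = {u \<in> BV \<Omega>. \<exists>\<mu> \<sigma> N. BV_derivative \<Omega> u \<mu> \<sigma> \<and> singular_carrier \<mu> N \<and>
                 (\<forall>B \<in> sets borel. cantor_part \<Omega> u \<mu> \<sigma> N B = 0)}"

definition compactly_supported_in :: "plane set \<Rightarrow> (plane \<Rightarrow> real) \<Rightarrow> bool" where
  "compactly_supported_in \<Omega> v \<longleftrightarrow>
     (\<exists>K. compact K \<and> K \<subseteq> \<Omega> \<and> (AE x in lebesgue_on \<Omega>. x \<notin> K \<longrightarrow> v x = 0))"

definition least_gradient :: "plane set \<Rightarrow> (plane \<Rightarrow> real) \<Rightarrow> (plane \<Rightarrow> real) \<Rightarrow> bool" where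
  "least_gradient \<Omega> \<phi> u \<longleftrightarrow> u \<in> BV \<Omega> \<and>
     (\<forall>v \<in> BV \<Omega>. compactly_supported_in \<Omega> v \<longrightarrow>
        phi_variation \<Omega> \<phi> u \<le> phi_variation \<Omega> \<phi> (\<lambda>x. u x + v x))"

definition least_gradient_solution ::
    "plane set \<Rightarrow> (plane \<Rightarrow> real) \<Rightarrow> (plane \<Rightarrow> real) \<Rightarrow> (plane \<Rightarrow> real) \<Rightarrow> bool" where
  "least_gradient_solution \<Omega> \<phi> f u \<longleftrightarrow> least_gradient \<Omega> \<phi> u \<and> has_trace \<Omega> u f"

end

theory Submission
  imports Defs
begin

text \<open>
  One function serves as boundary datum and as both solutions: \<open>u(x) = c((x - a) \<bullet> e)\<close>, where \<open>c\<close> is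
  the Cantor function extended by constants, \<open>a\<close> is a point of the domain and \<open>e\<close> is a suitable
  direction.

  Since \<open>c\<close> is nondecreasing, \<open>Du\<close> is a positive measure times \<open>e\<close>. Choose \<open>e\<close> with
  \<open>\<phi> e \<le> 1\<close> where some linear functional attains its maximum over the unit ball, and normalise the
  functional to a vector \<open>z\<^sub>0\<close> with \<open>z\<^sub>0 \<bullet> e = 1\<close> and dual norm at most 1
  (\<open>exists_dual_pair\<close>). The constant field \<open>z\<^sub>0\<close> calibrates \<open>u\<close>: no admissible field
  \<open>z\<close> satisfies \<open>z \<bullet> e < -1\<close>, whereas \<open>-z\<^sub>0\<close> attains the value \<open>-1\<close> everywhere. A constant field
  is not compactly supported, but multiplied by a cutoff that equals 1 on the supports of \<open>z\<close> and
  of a competitor's perturbation it bounds \<open>\<integral> u div z\<close>, and it does not see the perturbation, because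
  its divergence vanishes there (\<open>cantor_ridge_least_gradient\<close>). The trace condition is immediate
  because \<open>u\<close> is continuous on the plane.

  Being continuous, \<open>u\<close> has no approximate discontinuities, so that its Cantor part is the whole
  singular part of \<open>Du\<close>. If \<open>u\<close> were in \<open>SBV\<close>, its derivative would therefore be absolutely
  continuous, as it would be if \<open>u\<close> were in \<open>W\<^sup>1\<^sup>,\<^sup>1\<close>. Both are excluded by
  \<open>cantor_ridge_not_absolutely_continuous\<close>: there are \<open>C\<^sup>1\<close> cutoffs \<open>\<theta>\<^sub>n\<close> that equal 1 near the
  Cantor set and tend to 0 in \<open>L\<^sup>1\<close>. Multiplying a test function by \<open>\<theta>\<^sub>n\<close> does not change its
  pairing with \<open>Du\<close>, but makes its pairing with any absolutely continuous measure tend to 0. Hence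
  all pairings with \<open>Du\<close> would vanish, and \<open>c\<close> would not increase to the right of 0.

  Everything is computed with \<open>C\<^sup>1\<close> approximations \<open>c\<^sub>n\<close> of \<open>c\<close>, whose derivatives are explicit.
  Apart from dominated convergence, the only tool for integrals in the plane is that the integral
  of a directional derivative of a compactly supported \<open>C\<^sup>1\<close> function is 0, which follows from
  translation invariance.
\<close>

section \<open>A continuously differentiable step\<close>

lemma DERIV_pos_part_power:
  fixes t :: real
  shows "((\<lambda>t. (max 0 t) ^ Suc (Suc n)) has_real_derivative
            real (Suc (Suc n)) * (max 0 t) ^ Suc n) (at t)"
proof -
  consider "t < 0" | "t > 0" | "t = 0" by linarith
  then show ?thesis
  proof cases
    case 1
    have "((\<lambda>t::real. 0) has_real_derivative 0) (at t)" by simp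
    then have "((\<lambda>t::real. (max 0 t) ^ Suc (Suc n)) has_real_derivative 0) (at t)"
      by (rule has_field_derivative_transform_within_open[where S = "{..<0}"]) (use 1 in auto)
    then show ?thesis using 1 by simp
  next
    case 2
    have "((\<lambda>t::real. t ^ Suc (Suc n)) has_real_derivative real (Suc (Suc n)) * t ^ Suc n) (at t)"
      by (rule derivative_eq_intros refl | simp)+
    then have "((\<lambda>t::real. (max 0 t) ^ Suc (Suc n)) has_real_derivative
        real (Suc (Suc n)) * t ^ Suc n) (at t)"
      by (rule has_field_derivative_transform_within_open[where S = "{0<..}"]) (use 2 in auto)
    then show ?thesis using 2 by simp
  next
    case 3
    have "((\<lambda>h::real. (max 0 h) ^ Suc n * (max 0 h / h)) \<longlongrightarrow> 0) (at 0)"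
    proof (rule Lim_null_comparison)
      show "\<forall>\<^sub>F h::real in at 0. norm ((max 0 h) ^ Suc n * (max 0 h / h)) \<le> (max 0 h) ^ Suc n"
        by (rule always_eventually) (auto simp: max_def)
      have "isCont (\<lambda>h::real. (max 0 h) ^ Suc n) 0"
        by (intro continuous_intros)
      then show "((\<lambda>h::real. (max 0 h) ^ Suc n) \<longlongrightarrow> 0) (at 0)"
        by (simp add: isCont_def)
    qed
    moreover have "(max 0 h) ^ Suc (Suc n) / h = (max 0 h) ^ Suc n * (max 0 h / h)" for h :: real
      by simp
    ultimately show ?thesis using 3 by (simp add: DERIV_def mult_ac)
  qed
qed

text \<open>Each of these functions is the derivative of the next: a tent of mass 1 on the unit interval, the
  step from 0 to 1 with that density, and its integral. Each is a combination of translates of one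
  power of the positive part of \<open>t\<close>.\<close>
definition tent :: "real \<Rightarrow> real" where
  "tent t = 4 * (max 0 t - 2 * max 0 (t - 1/2) + max 0 (t - 1))"

definition smooth_step :: "real \<Rightarrow> real" where
  "smooth_step t = 2 * ((max 0 t)\<^sup>2 - 2 * (max 0 (t - 1/2))\<^sup>2 + (max 0 (t - 1))\<^sup>2)"

definition step_primitive :: "real \<Rightarrow> real" where
  "step_primitive t = 2/3 * ((max 0 t) ^ 3 - 2 * (max 0 (t - 1/2)) ^ 3 + (max 0 (t - 1)) ^ 3)"

lemma DERIV_shifted_pos_part:
  fixes t a :: real
  shows "((\<lambda>t. (max 0 (t - a))\<^sup>2) has_real_derivative 2 * max 0 (t - a)) (at t)"
    and "((\<lambda>t. (max 0 (t - a)) ^ 3) has_real_derivative 3 * (max 0 (t - a))\<^sup>2) (at t)"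
proof -
  have "((\<lambda>t. t - a) has_real_derivative 1) (at t)"
    by (auto intro!: derivative_eq_intros)
  note shift = DERIV_chain2[OF DERIV_pos_part_power this]
  show "((\<lambda>t. (max 0 (t - a))\<^sup>2) has_real_derivative 2 * max 0 (t - a)) (at t)"
    using shift[of 0] by (simp add: numeral_2_eq_2)
  show "((\<lambda>t. (max 0 (t - a)) ^ 3) has_real_derivative 3 * (max 0 (t - a))\<^sup>2) (at t)"
    using shift[of 1] by (simp add: numeral_2_eq_2 numeral_3_eq_3)
qed

lemma DERIV_smooth_step: "(smooth_step has_real_derivative tent t) (at t)"
proof -
  note d = DERIV_shifted_pos_part(1)
  have "((\<lambda>t. 2 * ((max 0 t)\<^sup>2 - 2 * (max 0 (t - 1/2))\<^sup>2 + (max 0 (t - 1))\<^sup>2))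
      has_real_derivative tent t) (at t)"
    using DERIV_cmult[OF DERIV_add[OF DERIV_diff[OF d[of 0 t, simplified] DERIV_cmult[OF d]] d]]
    by (rule DERIV_cong) (simp add: tent_def algebra_simps)
  then show ?thesis unfolding smooth_step_def[abs_def] .
qed

lemma DERIV_step_primitive: "(step_primitive has_real_derivative smooth_step t) (at t)"
proof -
  note d = DERIV_shifted_pos_part(2)
  have "((\<lambda>t. 2/3 * ((max 0 t) ^ 3 - 2 * (max 0 (t - 1/2)) ^ 3 + (max 0 (t - 1)) ^ 3))
      has_real_derivative smooth_step t) (at t)"
    using DERIV_cmult[OF DERIV_add[OF DERIV_diff[OF d[of 0 t, simplified] DERIV_cmult[OF d]] d]]
    by (rule DERIV_cong) (simp add: smooth_step_def algebra_simps)
  then show ?thesis unfolding step_primitive_def[abs_def] .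
qed

lemma continuous_tent [continuous_intros]: "continuous_on S tent"
  unfolding tent_def[abs_def] by (intro continuous_intros)

lemma continuous_smooth_step: "continuous_on S smooth_step"
  unfolding smooth_step_def[abs_def] by (intro continuous_intros)

lemma tent_nonneg: "0 \<le> tent t"
  by (auto simp: tent_def max_def)

lemma tent_eq_0: "t \<le> 0 \<or> 1 \<le> t \<Longrightarrow> tent t = 0"
  by (auto simp: tent_def max_def)

lemma smooth_step_eq_0: "t \<le> 0 \<Longrightarrow> smooth_step t = 0"
  by (auto simp: smooth_step_def max_def)

lemma smooth_step_eq_1: "1 \<le> t \<Longrightarrow> smooth_step t = 1"
  by (auto simp: smooth_step_def max_def power2_eq_square algebra_simps)

lemma mono_smooth_step: "s \<le> t \<Longrightarrow> smooth_step s \<le> smooth_step t"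
  by (rule DERIV_nonneg_imp_nondecreasing) (use DERIV_smooth_step tent_nonneg in blast)+

lemma smooth_step_bounds: "0 \<le> smooth_step t" "smooth_step t \<le> 1"
proof -
  show "0 \<le> smooth_step t"
    using mono_smooth_step[of "min 0 t" t] by (simp add: smooth_step_eq_0)
  show "smooth_step t \<le> 1"
    using mono_smooth_step[of t "max 1 t"] by (simp add: smooth_step_eq_1)
qed

section \<open>Differentiable approximations of the Cantor function\<close>

text \<open>Two copies of \<open>f\<close>, contracted by 3 towards 0 and towards 1 and multiplied by \<open>a\<close>, are added, and
  this is repeated. For \<open>a = 1/2\<close> the Cantor function is a fixed point. Differentiation only
  multiplies \<open>a\<close> by 3, so that one construction yields approximants of the Cantor function, their
  densities, cutoffs around the Cantor set, and the primitives and derivatives of these cutoffs.\<close>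
primrec cantor_iterate :: "real \<Rightarrow> (real \<Rightarrow> real) \<Rightarrow> nat \<Rightarrow> real \<Rightarrow> real" where
  "cantor_iterate a f 0 = f"
| "cantor_iterate a f (Suc n) =
     (\<lambda>t. a * (cantor_iterate a f n (3 * t) + cantor_iterate a f n (3 * t - 2)))"

lemma DERIV_cantor_iterate:
  assumes "\<And>t. (f has_real_derivative f' t) (at t)"
  shows "(cantor_iterate a f n has_real_derivative cantor_iterate (3 * a) f' n t) (at t)"
proof (induction n arbitrary: t)
  case (Suc n)
  have "((\<lambda>t. 3 * t) has_real_derivative 3) (at t)"
    and "((\<lambda>t. 3 * t - 2) has_real_derivative 3) (at t)"
    by (auto intro!: derivative_eq_intros)
  from DERIV_chain2[OF Suc this(1)] DERIV_chain2[OF Suc this(2)] show ?case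
    by (auto intro!: derivative_eq_intros simp: algebra_simps)
qed (use assms in simp)

lemma continuous_cantor_iterate:
  assumes "continuous_on UNIV f"
  shows "continuous_on UNIV (cantor_iterate a f n)"
proof (induction n)
  case (Suc n)
  show ?case
    by (auto intro!: continuous_intros continuous_on_compose2[OF Suc])
qed (use assms in simp)

text \<open>For \<open>a < 1/2\<close> the iterates tend to 0 geometrically; this is how the total mass of the cutoffs
  around the Cantor set is controlled.\<close>
lemma cantor_iterate_bound:
  assumes "\<And>t. \<bar>f t\<bar> \<le> M" "0 \<le> a"
  shows "\<bar>cantor_iterate a f n t\<bar> \<le> (2 * a) ^ n * M"
proof (induction n arbitrary: t)
  case (Suc n)
  have "\<bar>cantor_iterate a f (Suc n) t\<bar>
      \<le> a * (\<bar>cantor_iterate a f n (3 * t)\<bar> + \<bar>cantor_iterate a f n (3 * t - 2)\<bar>)"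
    using assms(2) by (simp add: abs_mult mult_left_mono)
  also have "\<dots> \<le> a * ((2 * a) ^ n * M + (2 * a) ^ n * M)"
    by (intro mult_left_mono add_mono Suc assms)
  finally show ?case by (simp add: algebra_simps)
qed (use assms in simp)

definition cantor_approx :: "nat \<Rightarrow> real \<Rightarrow> real" where
  "cantor_approx = cantor_iterate (1/2) smooth_step"

definition cantor_density :: "nat \<Rightarrow> real \<Rightarrow> real" where
  "cantor_density = cantor_iterate (3/2) tent"

lemma DERIV_cantor_approx: "(cantor_approx n has_real_derivative cantor_density n t) (at t)"
  using DERIV_cantor_iterate[of smooth_step tent "1/2" n t] DERIV_smooth_step
  by (simp add: cantor_approx_def cantor_density_def)

lemma cantor_density_nonneg: "0 \<le> cantor_density n t"
  unfolding cantor_density_def by (induction n arbitrary: t) (auto simp: tent_nonneg)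

lemma cantor_density_eq_0: "t \<le> 0 \<or> 1 \<le> t \<Longrightarrow> cantor_density n t = 0"
  unfolding cantor_density_def by (induction n arbitrary: t) (auto simp: tent_eq_0)

lemma continuous_cantor_density: "continuous_on UNIV (cantor_density n)"
  unfolding cantor_density_def by (intro continuous_cantor_iterate continuous_tent)

lemma cantor_approx_eq_0: "t \<le> 0 \<Longrightarrow> cantor_approx n t = 0"
  unfolding cantor_approx_def by (induction n arbitrary: t) (auto simp: smooth_step_eq_0)

lemma cantor_approx_eq_1: "1 \<le> t \<Longrightarrow> cantor_approx n t = 1"
  unfolding cantor_approx_def by (induction n arbitrary: t) (auto simp: smooth_step_eq_1)

lemma cantor_approx_bounds: "0 \<le> cantor_approx n t \<and> cantor_approx n t \<le> 1"
proof (induction n arbitrary: t)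
  case (Suc n)
  show ?case using Suc[of "3 * t"] Suc[of "3 * t - 2"] by (simp add: cantor_approx_def)
qed (simp add: cantor_approx_def smooth_step_bounds)

text \<open>At every point one of the two copies is constant, with the same value 0 or 1 for all \<open>n\<close>. Hence
  one step halves the distance between consecutive approximants.\<close>
lemma cantor_approx_Suc_diff: "\<bar>cantor_approx (Suc n) t - cantor_approx n t\<bar> \<le> (1/2) ^ n"
proof (induction n arbitrary: t)
  case 0
  show ?case using cantor_approx_bounds[of "Suc 0" t] cantor_approx_bounds[of 0 t]
    by (simp add: abs_le_iff)
next
  case (Suc n)
  have rec: "cantor_approx (Suc k) t = (cantor_approx k (3 * t) + cantor_approx k (3 * t - 2)) / 2" for k
    by (simp add: cantor_approx_def)
  show ?case
  proof (cases "3 * t \<le> 1")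
    case True
    then have "cantor_approx k (3 * t - 2) = 0" for k by (intro cantor_approx_eq_0) simp
    then have halve: "cantor_approx (Suc (Suc n)) t - cantor_approx (Suc n) t
        = (cantor_approx (Suc n) (3 * t) - cantor_approx n (3 * t)) / 2"
      by (simp add: rec[of "Suc n"] rec[of n] diff_divide_distrib add_divide_distrib)
    show ?thesis unfolding halve using Suc[of "3 * t"] by simp
  next
    case False
    then have "cantor_approx k (3 * t) = 1" for k by (intro cantor_approx_eq_1) simp
    then have halve: "cantor_approx (Suc (Suc n)) t - cantor_approx (Suc n) t
        = (cantor_approx (Suc n) (3 * t - 2) - cantor_approx n (3 * t - 2)) / 2"
      by (simp add: rec[of "Suc n"] rec[of n] diff_divide_distrib add_divide_distrib)
    show ?thesis unfolding halve using Suc[of "3 * t - 2"] by simp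
  qed
qed

definition cantor_function :: "real \<Rightarrow> real" where
  "cantor_function t = lim (\<lambda>n. cantor_approx n t)"

lemma uniform_limit_cantor: "uniform_limit UNIV cantor_approx cantor_function sequentially"
proof -
  have "uniformly_convergent_on UNIV (\<lambda>n t. \<Sum>i<n. cantor_approx (Suc i) t - cantor_approx i t)"
    by (rule Weierstrass_m_test'[where M = "\<lambda>n. (1/2) ^ n"])
       (use cantor_approx_Suc_diff in \<open>auto intro: summable_geometric\<close>)
  moreover have "(\<Sum>i<n. cantor_approx (Suc i) t - cantor_approx i t)
      = cantor_approx n t - cantor_approx 0 t" for n t
    by (rule sum_lessThan_telescope)
  ultimately obtain l where
    "uniform_limit UNIV (\<lambda>n t. cantor_approx n t - cantor_approx 0 t) l sequentially"
    by (auto simp: uniformly_convergent_on_def)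
  then have "uniform_limit UNIV (\<lambda>n t. (cantor_approx n t - cantor_approx 0 t) + cantor_approx 0 t)
      (\<lambda>t. l t + cantor_approx 0 t) sequentially"
    by (intro uniform_limit_intros)
  then have *: "uniform_limit UNIV cantor_approx (\<lambda>t. l t + cantor_approx 0 t) sequentially"
    by simp
  have "cantor_function = (\<lambda>t. l t + cantor_approx 0 t)"
    unfolding cantor_function_def using tendsto_uniform_limitI[OF *] by (auto intro!: limI)
  then show ?thesis using * by simp
qed

lemma cantor_tendsto: "(\<lambda>n. cantor_approx n t) \<longlonglongrightarrow> cantor_function t"
  by (rule tendsto_uniform_limitI[OF uniform_limit_cantor]) simp

lemma continuous_cantor_approx: "continuous_on UNIV (cantor_approx n)"
  unfolding cantor_approx_def by (intro continuous_cantor_iterate continuous_smooth_step)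

lemma continuous_cantor: "continuous_on UNIV cantor_function"
  by (rule uniform_limit_theorem[OF _ uniform_limit_cantor]) (auto simp: continuous_cantor_approx)

lemma cantor_bounds: "0 \<le> cantor_function t" "cantor_function t \<le> 1"
  using LIMSEQ_le_const[OF cantor_tendsto] LIMSEQ_le_const2[OF cantor_tendsto]
    cantor_approx_bounds by blast+

lemma cantor_eq_0: "t \<le> 0 \<Longrightarrow> cantor_function t = 0"
  using LIMSEQ_unique[OF cantor_tendsto[of t]] by (simp add: cantor_approx_eq_0)

lemma cantor_eq_1: "1 \<le> t \<Longrightarrow> cantor_function t = 1"
  using LIMSEQ_unique[OF cantor_tendsto[of t]] by (simp add: cantor_approx_eq_1)

lemma cantor_self_similar:
  "cantor_function t = (cantor_function (3 * t) + cantor_function (3 * t - 2)) / 2"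
proof -
  have "(\<lambda>n. cantor_approx (Suc n) t) \<longlonglongrightarrow>
      (cantor_function (3 * t) + cantor_function (3 * t - 2)) / 2"
    unfolding cantor_approx_def cantor_iterate.simps
    unfolding cantor_approx_def[symmetric] mult.commute[of "1/2"] times_divide_eq_right mult_1_right
    by (intro tendsto_intros cantor_tendsto) simp
  with LIMSEQ_Suc[OF cantor_tendsto[of t]] show ?thesis by (rule LIMSEQ_unique)
qed

text \<open>By self-similarity \<open>c(t) \<ge> c(3t) / 2\<close>, and \<open>c = 1\<close> to the right of 1: repeated tripling moves
  \<open>t\<close> there.\<close>
lemma cantor_pos: assumes "0 < t" shows "0 < cantor_function t"
proof -
  have *: "1 \<le> 3 ^ n * t \<Longrightarrow> 0 < cantor_function t" if "0 < t" for n t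
    using that
  proof (induction n arbitrary: t)
    case 0
    then show ?case by (simp add: cantor_eq_1)
  next
    case (Suc n)
    then have "0 < cantor_function (3 * t)" by (intro Suc.IH) (simp_all add: mult_ac)
    then show ?case using cantor_self_similar[of t] cantor_bounds(1)[of "3 * t - 2"] by simp
  qed
  obtain n where "1 / t < 3 ^ n" using real_arch_pow[of 3 "1 / t"] by auto
  then show ?thesis using *[of t n] assms by (simp add: field_simps)
qed

section \<open>Cutoffs around the Cantor set\<close>

text \<open>The margin 1/4 keeps the supports of the two contracted copies disjoint, which requires a margin
  below 1/2.\<close>
definition plateau :: "real \<Rightarrow> real" where
  "plateau t = smooth_step (4 * t + 1) - smooth_step (4 * t - 4)"

definition plateau_primitive :: "real \<Rightarrow> real" where
  "plateau_primitive t = (step_primitive (4 * t + 1) - step_primitive (4 * t - 4)) / 4"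

lemma DERIV_plateau:
  "(plateau has_real_derivative 4 * tent (4 * t + 1) - 4 * tent (4 * t - 4)) (at t)"
  unfolding plateau_def[abs_def]
  by (auto intro!: derivative_eq_intros DERIV_chain2[OF DERIV_smooth_step])

lemma DERIV_plateau_primitive: "(plateau_primitive has_real_derivative plateau t) (at t)"
  unfolding plateau_def plateau_primitive_def[abs_def]
  by (auto intro!: derivative_eq_intros DERIV_chain2[OF DERIV_step_primitive])

lemma plateau_bounds: "0 \<le> plateau t" "plateau t \<le> 1"
  using mono_smooth_step[of "4 * t - 4" "4 * t + 1"] smooth_step_bounds[of "4 * t - 4"]
    smooth_step_bounds[of "4 * t + 1"]
  by (auto simp: plateau_def)

lemma plateau_eq_1: "0 \<le> t \<Longrightarrow> t \<le> 1 \<Longrightarrow> plateau t = 1"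
  by (simp add: plateau_def smooth_step_eq_0 smooth_step_eq_1)

lemma plateau_eq_0: "t \<le> - (1/4) \<or> 5/4 \<le> t \<Longrightarrow> plateau t = 0"
  by (auto simp: plateau_def smooth_step_eq_0 smooth_step_eq_1)

text \<open>The mean value theorem is applied on an interval of length 5 to a function with derivative
  between 0 and 1.\<close>
lemma plateau_primitive_bound: "\<bar>plateau_primitive t\<bar> \<le> 5/4"
proof -
  obtain s where "step_primitive (4 * t + 1) - step_primitive (4 * t - 4)
      = (4 * t + 1 - (4 * t - 4)) * smooth_step s"
    using MVT2[of "4 * t - 4" "4 * t + 1" step_primitive smooth_step] DERIV_step_primitive by auto
  then show ?thesis using smooth_step_bounds[of s] by (simp add: plateau_primitive_def)
qed

text \<open>The cutoff of stage \<open>n\<close> equals 1 wherever a Cantor density of stage at least \<open>n\<close> is nonzero. The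
  factor 1/3 for its primitive expresses that its mass decreases like \<open>(2/3)\<^sup>n\<close>.\<close>
definition cantor_cutoff :: "nat \<Rightarrow> real \<Rightarrow> real" where
  "cantor_cutoff = cantor_iterate 1 plateau"

definition cutoff_primitive :: "nat \<Rightarrow> real \<Rightarrow> real" where
  "cutoff_primitive = cantor_iterate (1/3) plateau_primitive"

definition cutoff_derivative :: "nat \<Rightarrow> real \<Rightarrow> real" where
  "cutoff_derivative = cantor_iterate 3 (\<lambda>t. 4 * tent (4 * t + 1) - 4 * tent (4 * t - 4))"

lemma DERIV_cutoff_primitive: "(cutoff_primitive n has_real_derivative cantor_cutoff n t) (at t)"
  using DERIV_cantor_iterate[OF DERIV_plateau_primitive, of "1/3" n t]
  by (simp add: cutoff_primitive_def cantor_cutoff_def)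

lemma DERIV_cantor_cutoff: "(cantor_cutoff n has_real_derivative cutoff_derivative n t) (at t)"
  using DERIV_cantor_iterate[OF DERIV_plateau, of 1 n t]
  by (simp add: cutoff_derivative_def cantor_cutoff_def)

lemma continuous_cutoff_derivative: "continuous_on UNIV (cutoff_derivative n)"
  unfolding cutoff_derivative_def
  by (intro continuous_cantor_iterate continuous_intros continuous_on_compose2[OF continuous_tent]) auto

lemma continuous_cantor_cutoff: "continuous_on UNIV (cantor_cutoff n)"
  using DERIV_cantor_cutoff by (meson DERIV_continuous_on has_field_derivative_at_within)

lemma cutoff_primitive_bound: "\<bar>cutoff_primitive n t\<bar> \<le> (2/3) ^ n * (5/4)"
  using cantor_iterate_bound[of plateau_primitive "5/4" "1/3" n t] plateau_primitive_bound
  by (simp add: cutoff_primitive_def)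

lemma cantor_cutoff_eq_0: "t \<le> - (1/4) \<or> 5/4 \<le> t \<Longrightarrow> cantor_cutoff n t = 0"
  unfolding cantor_cutoff_def by (induction n arbitrary: t) (auto simp: plateau_eq_0)

lemma cantor_cutoff_bounds: "0 \<le> cantor_cutoff n t \<and> cantor_cutoff n t \<le> 1"
proof (induction n arbitrary: t)
  case (Suc n)
  have rec: "cantor_cutoff (Suc n) t = cantor_cutoff n (3 * t) + cantor_cutoff n (3 * t - 2)"
    by (simp add: cantor_cutoff_def)
  show ?case
  proof (cases "3 * t - 2 \<le> - (1/4)")
    case True
    then show ?thesis using Suc[of "3 * t"] cantor_cutoff_eq_0[of "3 * t - 2" n] by (simp add: rec)
  next
    case False
    then show ?thesis using Suc[of "3 * t - 2"] cantor_cutoff_eq_0[of "3 * t" n] by (simp add: rec)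
  qed
qed (simp add: cantor_cutoff_def plateau_bounds)

text \<open>A point in the support of a later density lies in exactly one of the two contracted copies at each
  step; the other copy of the cutoff contributes 0 there, because of the margin.\<close>
lemma cantor_cutoff_eq_1:
  assumes "cantor_density (n + k) t \<noteq> 0"
  shows "cantor_cutoff n t = 1"
  using assms
proof (induction n arbitrary: t)
  case 0
  then show ?case using cantor_density_eq_0[of t] by (force simp: cantor_cutoff_def intro: plateau_eq_1)
next
  case (Suc n)
  have rec: "cantor_cutoff (Suc n) t = cantor_cutoff n (3 * t) + cantor_cutoff n (3 * t - 2)"
    by (simp add: cantor_cutoff_def)
  consider "cantor_density (n + k) (3 * t) \<noteq> 0" | "cantor_density (n + k) (3 * t - 2) \<noteq> 0"
    using Suc.prems by (force simp: cantor_density_def)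
  then show ?case
  proof cases
    case 1
    then have "3 * t < 1" using cantor_density_eq_0[of "3 * t"] by force
    then show ?thesis using Suc.IH[OF 1] cantor_cutoff_eq_0[of "3 * t - 2" n] by (simp add: rec)
  next
    case 2
    then have "0 < 3 * t - 2" using cantor_density_eq_0[of "3 * t - 2"] by force
    then show ?thesis using Suc.IH[OF 2] cantor_cutoff_eq_0[of "3 * t" n] by (simp add: rec)
  qed
qed

section \<open>Test functions\<close>

abbreviation derivative_at :: "(plane \<Rightarrow> 'b::real_normed_vector) \<Rightarrow> plane \<Rightarrow> plane \<Rightarrow> 'b" where
  "derivative_at z x \<equiv> frechet_derivative z (at x)"

lemma derivative_at_eq: "(z has_derivative D) (at x) \<Longrightarrow> derivative_at z x = D"
  by (rule frechet_derivative_at[symmetric])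

lemma Cc1_I:
  fixes z :: "plane \<Rightarrow> 'b::real_normed_vector"
  assumes "\<And>x. (z has_derivative D x) (at x)"
    and "\<And>v. continuous_on UNIV (\<lambda>x. D x v)"
    and "compact K" "K \<subseteq> \<Omega>" "\<And>x. x \<notin> K \<Longrightarrow> z x = 0"
  shows "z \<in> Cc1 \<Omega>"
proof -
  have "derivative_at z x = D x" for x
    by (rule derivative_at_eq[OF assms(1)])
  then show ?thesis
    using assms unfolding Cc1_def differentiable_def by auto
qed

lemma Cc1_has_derivative:
  "z \<in> Cc1 \<Omega> \<Longrightarrow> (z has_derivative derivative_at z x) (at x)"
  by (simp add: Cc1_def frechet_derivative_works)

lemma Cc1_continuous_derivative:
  "z \<in> Cc1 \<Omega> \<Longrightarrow> continuous_on UNIV (\<lambda>x. derivative_at z x v)"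
  by (simp add: Cc1_def)

lemma Cc1_continuous:
  assumes "z \<in> Cc1 \<Omega>" shows "continuous_on UNIV z"
  using Cc1_has_derivative[OF assms]
  by (meson continuous_at_imp_continuous_on has_derivative_continuous)

lemma Cc1_mono: "\<Omega> \<subseteq> \<Omega>' \<Longrightarrow> z \<in> Cc1 \<Omega> \<Longrightarrow> z \<in> Cc1 \<Omega>'"
  unfolding Cc1_def by blast

lemma derivative_at_eq_0:
  assumes "closed K" "\<And>x. x \<notin> K \<Longrightarrow> z x = 0" "x \<notin> K"
  shows "derivative_at z x v = 0"
proof -
  have "((\<lambda>x. 0) has_derivative (\<lambda>v. 0)) (at x)" by simp
  then have "(z has_derivative (\<lambda>v. 0)) (at x)"
    by (rule has_derivative_transform_within_open[of _ _ _ UNIV "- K"]) (use assms in auto)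
  then show ?thesis by (simp add: derivative_at_eq)
qed

lemma Cc1_support:
  assumes "z \<in> Cc1 \<Omega>"
  obtains K where "compact K" "K \<subseteq> \<Omega>" "\<And>x. x \<notin> K \<Longrightarrow> z x = 0"
    "\<And>x v. x \<notin> K \<Longrightarrow> derivative_at z x v = 0"
proof -
  obtain K where K: "compact K" "K \<subseteq> \<Omega>" "\<And>x. x \<notin> K \<Longrightarrow> z x = 0"
    using assms unfolding Cc1_def by blast
  show ?thesis
    by (rule that[OF K derivative_at_eq_0[OF compact_imp_closed[OF K(1)] K(3)]])
qed

lemma integrable_compact_support:
  fixes g :: "plane \<Rightarrow> real"
  assumes "continuous_on UNIV g" "compact K" "\<And>x. x \<notin> K \<Longrightarrow> g x = 0"
  shows "integrable lborel g"
proof -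
  have "integrable lborel (\<lambda>x. indicator K x *\<^sub>R g x)"
    using borel_integrable_compact[OF assms(2)] continuous_on_subset[OF assms(1)] by blast
  moreover have "(\<lambda>x. indicator K x *\<^sub>R g x) = g"
    using assms(3) by (auto simp: indicator_def fun_eq_iff)
  ultimately show ?thesis by simp
qed

lemma integrable_mult_Cc1:
  fixes \<psi> :: "plane \<Rightarrow> real"
  assumes "continuous_on UNIV h" "\<psi> \<in> Cc1 \<Omega>"
  shows "integrable lborel (\<lambda>x. h x * \<psi> x)" "integrable lborel (\<lambda>x. h x * derivative_at \<psi> x v)"
proof -
  obtain K where K: "compact K" "K \<subseteq> \<Omega>" "\<And>x. x \<notin> K \<Longrightarrow> \<psi> x = 0"
    "\<And>x v. x \<notin> K \<Longrightarrow> derivative_at \<psi> x v = 0"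
    by (rule Cc1_support[OF assms(2)]) auto
  show "integrable lborel (\<lambda>x. h x * \<psi> x)"
    by (rule integrable_compact_support[OF _ K(1)])
       (use K assms Cc1_continuous in \<open>auto intro!: continuous_intros\<close>)
  show "integrable lborel (\<lambda>x. h x * derivative_at \<psi> x v)"
    by (rule integrable_compact_support[OF _ K(1)])
       (use K assms Cc1_continuous_derivative in \<open>auto intro!: continuous_intros\<close>)
qed

text \<open>Translation invariance makes the integral of every difference quotient 0. The quotients
  converge boundedly, with supports in a common ball.\<close>
lemma integral_derivative_eq_0:
  fixes \<psi> :: "plane \<Rightarrow> real"
  assumes "\<psi> \<in> Cc1 UNIV"
  shows "(\<integral>x. derivative_at \<psi> x v \<partial>lborel) = 0"
proof -
  obtain K where K: "compact K" "\<And>x. x \<notin> K \<Longrightarrow> \<psi> x = 0"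
    "\<And>x v. x \<notin> K \<Longrightarrow> derivative_at \<psi> x v = 0"
    by (rule Cc1_support[OF assms]) auto
  let ?F = "\<lambda>x. derivative_at \<psi> x v"
  note cont = Cc1_continuous[OF assms]
  have "bounded (?F ` K)"
    using K(1) Cc1_continuous_derivative[OF assms]
    by (intro compact_imp_bounded compact_continuous_image) (auto intro: continuous_on_subset)
  then obtain M where "\<And>x. x \<in> K \<Longrightarrow> \<bar>?F x\<bar> \<le> M"
    by (auto simp: bounded_iff)
  then have M: "\<bar>?F x\<bar> \<le> max 0 M" for x using K(3)[of x v] by (cases "x \<in> K") force+
  obtain R where R: "\<And>x. x \<in> K \<Longrightarrow> norm x \<le> R"
    using compact_imp_bounded[OF K(1)] by (auto simp: bounded_iff)
  define q where "q n x = real (Suc n) * (\<psi> (x + (1 / real (Suc n)) *\<^sub>R v) - \<psi> x)" for n x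
  define w where "w x = max 0 M * indicator (cball (0::plane) (R + norm v)) x" for x
  have line: "((\<lambda>t. \<psi> (x + t *\<^sub>R v)) has_derivative (\<lambda>s. s * ?F (x + t *\<^sub>R v))) (at t)" for x t
  proof -
    have "((\<lambda>t. x + t *\<^sub>R v) has_derivative (\<lambda>s. s *\<^sub>R v)) (at t)"
      by (auto intro!: derivative_eq_intros)
    from diff_chain_at[OF this Cc1_has_derivative[OF assms]]
    show ?thesis
      by (simp add: o_def linear_cmul[OF has_derivative_linear[OF Cc1_has_derivative[OF assms]]])
  qed
  have mvt: "\<exists>t. 0 \<le> t \<and> t \<le> 1 / real (Suc n) \<and> q n x = ?F (x + t *\<^sub>R v)" for n x
    using mvt_very_simple[of 0 "1 / real (Suc n)" "\<lambda>t. \<psi> (x + t *\<^sub>R v)"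
        "\<lambda>t s. s * ?F (x + t *\<^sub>R v)"] line[THEN has_derivative_at_withinI]
    by (auto simp: q_def)
  \<comment> \<open>By the mean value theorem the quotients are values of the derivative at distance at most
    \<open>norm v\<close>, which yields the majorant \<open>w\<close>.\<close>
  have "(\<lambda>n. integral\<^sup>L lborel (q n)) \<longlonglongrightarrow> integral\<^sup>L lborel ?F"
  proof (rule integral_dominated_convergence)
    show "?F \<in> borel_measurable lborel"
      using borel_measurable_continuous_onI[OF Cc1_continuous_derivative[OF assms]] by simp
    show "q n \<in> borel_measurable lborel" for n
    proof -
      have "continuous_on UNIV (q n)"
        unfolding q_def by (intro continuous_intros continuous_on_compose2[OF cont]) auto
      then show ?thesis using borel_measurable_continuous_onI by simp
    qed
    show "integrable lborel w"
      unfolding w_def by (intro integrable_mult_right integrable_real_indicator) (use emeasure_bounded_finite[OF bounded_cball] in auto)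
    show "AE x in lborel. (\<lambda>n. q n x) \<longlonglongrightarrow> ?F x"
    proof (rule AE_I2)
      fix x
      have "((\<lambda>t. \<psi> (x + t *\<^sub>R v)) has_real_derivative ?F x) (at 0)"
        using line[of x 0] by (simp add: has_field_derivative_def mult_commute_abs)
      then have "((\<lambda>t. (\<psi> (x + t *\<^sub>R v) - \<psi> x) / t) \<longlongrightarrow> ?F x) (at 0)"
        by (simp add: DERIV_def)
      moreover have "filterlim (\<lambda>n. 1 / real (Suc n)) (at 0) sequentially"
        unfolding filterlim_at using LIMSEQ_inverse_real_of_nat by (simp add: inverse_eq_divide)
      ultimately show "(\<lambda>n. q n x) \<longlonglongrightarrow> ?F x"
        unfolding q_def using filterlim_compose by (fastforce simp: mult.commute)
    qed
    show "AE x in lborel. norm (q n x) \<le> w x" for n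
    proof (rule AE_I2)
      fix x
      obtain t where t: "0 \<le> t" "t \<le> 1 / real (Suc n)" "q n x = ?F (x + t *\<^sub>R v)"
        using mvt by blast
      have "t \<le> 1" using t(2) by (rule order_trans) simp
      show "norm (q n x) \<le> w x"
      proof (cases "x + t *\<^sub>R v \<in> K")
        case True
        have "norm x \<le> norm (x + t *\<^sub>R v) + norm (t *\<^sub>R v)"
          using norm_triangle_ineq4[of "x + t *\<^sub>R v" "t *\<^sub>R v"] by simp
        also have "norm (t *\<^sub>R v) \<le> norm v" using t(1) \<open>t \<le> 1\<close> by (simp add: mult_left_le_one_le)
        finally have "norm x \<le> R + norm v" using R[OF True] by simp
        then show ?thesis using M t(3) by (simp add: w_def)
      next
        case False
        then show ?thesis using K(3) t(3) by (simp add: w_def)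
      qed
    qed
  qed
  moreover have "integral\<^sup>L lborel (q n) = 0" for n
  proof -
    have int: "integrable lborel \<psi>" by (rule integrable_compact_support[OF cont K(1,2)])
    let ?c = "(1 / real (Suc n)) *\<^sub>R v"
    have shift: "integrable lborel (\<lambda>x. \<psi> (?c + x))"
      "(\<integral>x. \<psi> (?c + x) \<partial>lborel) = integral\<^sup>L lborel \<psi>"
      using integrable_distr[of "(+) ?c" lborel borel \<psi>] integral_distr[of "(+) ?c" lborel borel \<psi>]
        int borel_measurable_continuous_onI[OF cont] lborel_distr_plus[of ?c] by simp_all
    show ?thesis
      using shift int unfolding q_def by (simp add: add.commute)
  qed
  ultimately show ?thesis by (simp add: LIMSEQ_const_iff)
qed

lemma Cc1_mult:
  fixes \<psi> :: "plane \<Rightarrow> 'b::real_normed_vector"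
  assumes "\<And>x. (h has_derivative Dh x) (at x)" "\<And>v. continuous_on UNIV (\<lambda>x. Dh x v)"
    and "\<psi> \<in> Cc1 \<Omega>"
  shows "(\<lambda>x. h x *\<^sub>R \<psi> x) \<in> Cc1 \<Omega>"
    and "derivative_at (\<lambda>x. h x *\<^sub>R \<psi> x) x v = h x *\<^sub>R derivative_at \<psi> x v + Dh x v *\<^sub>R \<psi> x"
proof -
  have der: "((\<lambda>x. h x *\<^sub>R \<psi> x) has_derivative
      (\<lambda>v. h x *\<^sub>R derivative_at \<psi> x v + Dh x v *\<^sub>R \<psi> x)) (at x)" for x
    using assms(1) Cc1_has_derivative[OF assms(3)] by (rule has_derivative_scaleR)
  obtain K where K: "compact K" "K \<subseteq> \<Omega>" "\<And>x. x \<notin> K \<Longrightarrow> \<psi> x = 0"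
    using Cc1_support[OF assms(3)] by metis
  have "continuous_on UNIV h"
    using assms(1) by (meson continuous_at_imp_continuous_on has_derivative_continuous)
  then show "(\<lambda>x. h x *\<^sub>R \<psi> x) \<in> Cc1 \<Omega>"
    by (intro Cc1_I[OF der _ K(1,2)] continuous_intros assms Cc1_continuous_derivative[OF assms(3)]
        Cc1_continuous[OF assms(3)]) (simp_all add: K(3))
  show "derivative_at (\<lambda>x. h x *\<^sub>R \<psi> x) x v = h x *\<^sub>R derivative_at \<psi> x v + Dh x v *\<^sub>R \<psi> x"
    using derivative_at_eq[OF der] by simp
qed

lemma Cc1_scaleR_const:
  fixes \<psi> :: "plane \<Rightarrow> real"
  assumes "\<psi> \<in> Cc1 \<Omega>"
  shows "(\<lambda>x. \<psi> x *\<^sub>R w) \<in> Cc1 \<Omega>"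
    and "derivative_at (\<lambda>x. \<psi> x *\<^sub>R w) x v = derivative_at \<psi> x v *\<^sub>R w"
proof -
  have der: "((\<lambda>x. \<psi> x *\<^sub>R w) has_derivative (\<lambda>v. derivative_at \<psi> x v *\<^sub>R w)) (at x)" for x
    using Cc1_has_derivative[OF assms] by (auto intro!: derivative_eq_intros)
  obtain K where K: "compact K" "K \<subseteq> \<Omega>" "\<And>x. x \<notin> K \<Longrightarrow> \<psi> x = 0"
    using Cc1_support[OF assms] by metis
  show "(\<lambda>x. \<psi> x *\<^sub>R w) \<in> Cc1 \<Omega>"
    by (intro Cc1_I[OF der _ K(1,2)] continuous_intros Cc1_continuous_derivative[OF assms])
       (simp add: K(3))
  show "derivative_at (\<lambda>x. \<psi> x *\<^sub>R w) x v = derivative_at \<psi> x v *\<^sub>R w"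
    using derivative_at_eq[OF der] by simp
qed

lemma Cc1_inner_const:
  fixes z :: "plane \<Rightarrow> plane"
  assumes "z \<in> Cc1 \<Omega>"
  shows "(\<lambda>x. z x \<bullet> w) \<in> Cc1 \<Omega>"
    and "derivative_at (\<lambda>x. z x \<bullet> w) x v = derivative_at z x v \<bullet> w"
proof -
  have der: "((\<lambda>x. z x \<bullet> w) has_derivative (\<lambda>v. derivative_at z x v \<bullet> w)) (at x)" for x
    using Cc1_has_derivative[OF assms] by (auto intro!: derivative_eq_intros)
  obtain K where K: "compact K" "K \<subseteq> \<Omega>" "\<And>x. x \<notin> K \<Longrightarrow> z x = 0"
    using Cc1_support[OF assms] by metis
  show "(\<lambda>x. z x \<bullet> w) \<in> Cc1 \<Omega>"
    by (intro Cc1_I[OF der _ K(1,2)] continuous_intros Cc1_continuous_derivative[OF assms])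
       (simp add: K(3))
  show "derivative_at (\<lambda>x. z x \<bullet> w) x v = derivative_at z x v \<bullet> w"
    using derivative_at_eq[OF der] by simp
qed

lemma Cc1_add:
  assumes "\<psi> \<in> Cc1 \<Omega>" "\<psi>' \<in> Cc1 \<Omega>"
  shows "(\<lambda>x. \<psi> x + \<psi>' x) \<in> Cc1 \<Omega>"
    and "derivative_at (\<lambda>x. \<psi> x + \<psi>' x) x v = derivative_at \<psi> x v + derivative_at \<psi>' x v"
proof -
  have der: "((\<lambda>x. \<psi> x + \<psi>' x) has_derivative
      (\<lambda>v. derivative_at \<psi> x v + derivative_at \<psi>' x v)) (at x)" for x
    using Cc1_has_derivative[OF assms(1)] Cc1_has_derivative[OF assms(2)]
    by (rule has_derivative_add)
  obtain K where K: "compact K" "K \<subseteq> \<Omega>" "\<And>x. x \<notin> K \<Longrightarrow> \<psi> x = 0"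
    using Cc1_support[OF assms(1)] by metis
  obtain K' where K': "compact K'" "K' \<subseteq> \<Omega>" "\<And>x. x \<notin> K' \<Longrightarrow> \<psi>' x = 0"
    using Cc1_support[OF assms(2)] by metis
  show "(\<lambda>x. \<psi> x + \<psi>' x) \<in> Cc1 \<Omega>"
    by (intro Cc1_I[OF der, of "K \<union> K'"] continuous_intros Cc1_continuous_derivative[OF assms(1)]
       Cc1_continuous_derivative[OF assms(2)])
       (use K K' in auto)
  show "derivative_at (\<lambda>x. \<psi> x + \<psi>' x) x v = derivative_at \<psi> x v + derivative_at \<psi>' x v"
    using derivative_at_eq[OF der] by simp
qed

lemma has_derivative_ridge:
  assumes "\<And>t. (f has_real_derivative f' t) (at t)"
  shows "((\<lambda>x. f ((x - a) \<bullet> e)) has_derivative (\<lambda>v. f' ((x - a) \<bullet> e) * (v \<bullet> e))) (at x)"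
proof -
  have "((\<lambda>x. (x - a) \<bullet> e) has_derivative (\<lambda>v. v \<bullet> e)) (at x)"
    by (auto intro!: derivative_eq_intros)
  from diff_chain_at[OF this assms[unfolded has_field_derivative_def]]
  show ?thesis by (simp add: o_def)
qed

text \<open>The integral of the derivative of the product \<open>f((x - a) \<bullet> e) \<psi>(x)\<close> vanishes.\<close>
lemma ridge_integration_by_parts:
  fixes \<psi> :: "plane \<Rightarrow> real"
  assumes "\<And>t. (f has_real_derivative f' t) (at t)" "continuous_on UNIV f'" "\<psi> \<in> Cc1 UNIV"
  shows "(\<integral>x. f ((x - a) \<bullet> e) * derivative_at \<psi> x v \<partial>lborel)
       = - (v \<bullet> e) * (\<integral>x. f' ((x - a) \<bullet> e) * \<psi> x \<partial>lborel)"
proof -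
  have contf: "continuous_on UNIV f"
    using assms(1) by (meson DERIV_isCont continuous_at_imp_continuous_on)
  have contL: "continuous_on UNIV (\<lambda>x. f ((x - a) \<bullet> e))" "continuous_on UNIV (\<lambda>x. f' ((x - a) \<bullet> e))"
    by (intro continuous_on_compose2[OF contf] continuous_on_compose2[OF assms(2)] continuous_intros; simp)+
  have cont: "continuous_on UNIV (\<lambda>x. f' ((x - a) \<bullet> e) * (v \<bullet> e))" for v
    by (intro continuous_intros contL)
  have ridge: "((\<lambda>x. f ((x - a) \<bullet> e)) has_derivative (\<lambda>v. f' ((x - a) \<bullet> e) * (v \<bullet> e))) (at x)" for x
    by (rule has_derivative_ridge[OF assms(1)])
  note prod = Cc1_mult[OF ridge cont assms(3)]
  have "0 = (\<integral>x. f ((x - a) \<bullet> e) * derivative_at \<psi> x v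
                 + (v \<bullet> e) * (f' ((x - a) \<bullet> e) * \<psi> x) \<partial>lborel)"
    using integral_derivative_eq_0[OF prod(1), of v] prod(2)[of _ v]
    by (simp add: mult_ac)
  also have "\<dots> = (\<integral>x. f ((x - a) \<bullet> e) * derivative_at \<psi> x v \<partial>lborel)
                 + (v \<bullet> e) * (\<integral>x. f' ((x - a) \<bullet> e) * \<psi> x \<partial>lborel)"
    by (subst Bochner_Integration.integral_add)
       (auto intro!: integrable_mult_Cc1 contL assms(3) integrable_mult_right)
  finally show ?thesis by simp
qed

section \<open>Cutoff functions in the plane\<close>

definition bump :: "plane \<Rightarrow> real \<Rightarrow> plane \<Rightarrow> real" where
  "bump a r x = (max 0 (r\<^sup>2 - (x - a) \<bullet> (x - a)))\<^sup>2"

lemma has_derivative_bump: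
  "(bump a r has_derivative (\<lambda>v. - 4 * max 0 (r\<^sup>2 - (x - a) \<bullet> (x - a)) * ((x - a) \<bullet> v))) (at x)"
proof -
  have "((\<lambda>x. r\<^sup>2 - (x - a) \<bullet> (x - a)) has_derivative (\<lambda>v. - 2 * ((x - a) \<bullet> v))) (at x)"
    by (auto intro!: derivative_eq_intros simp: inner_commute)
  from diff_chain_at[OF this DERIV_pos_part_power[of 0, unfolded has_field_derivative_def]]
  have "((\<lambda>x. (max 0 (r\<^sup>2 - (x - a) \<bullet> (x - a))) ^ 2) has_derivative
      (\<lambda>v. - 4 * max 0 (r\<^sup>2 - (x - a) \<bullet> (x - a)) * ((x - a) \<bullet> v))) (at x)"
    by (simp add: o_def numeral_2_eq_2 mult_ac)
  then show ?thesis unfolding bump_def[abs_def] .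
qed

lemma derivative_at_bump:
  "derivative_at (bump a r) x v = - 4 * max 0 (r\<^sup>2 - (x - a) \<bullet> (x - a)) * ((x - a) \<bullet> v)"
  using derivative_at_eq[OF has_derivative_bump] by simp

lemma bump_nonneg: "0 \<le> bump a r x"
  by (simp add: bump_def)

lemma inside_ball_iff:
  fixes a :: plane
  assumes "0 < r" shows "0 < r\<^sup>2 - (x - a) \<bullet> (x - a) \<longleftrightarrow> x \<in> ball a r"
proof -
  have "(x - a) \<bullet> (x - a) = (dist a x)\<^sup>2"
    by (simp add: dist_norm power2_norm_eq_inner norm_minus_commute[of a x])
  moreover have "(dist a x)\<^sup>2 < r\<^sup>2 \<longleftrightarrow> dist a x < r"
    using assms by (simp add: power_mono_iff flip: not_le)
  ultimately show ?thesis by simp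
qed

lemma bump_pos_iff: "0 < r \<Longrightarrow> 0 < bump a r x \<longleftrightarrow> x \<in> ball a r"
  using inside_ball_iff[of r x a] by (auto simp: bump_def max_def)

lemma bump_in_Cc1:
  assumes "0 < r" "cball a r \<subseteq> \<Omega>" shows "bump a r \<in> Cc1 \<Omega>"
proof (rule Cc1_I[OF has_derivative_bump _ compact_cball assms(2)])
  show "continuous_on UNIV (\<lambda>x. - 4 * max 0 (r\<^sup>2 - (x - a) \<bullet> (x - a)) * ((x - a) \<bullet> v))" for v
    by (intro continuous_intros)
  show "bump a r x = 0" if "x \<notin> cball a r" for x
    using bump_pos_iff[OF assms(1), of a x] bump_nonneg[of a r x] that by force
qed

lemma zero_in_Cc1: "(\<lambda>x. 0) \<in> Cc1 \<Omega>"
  by (rule Cc1_I[of _ "\<lambda>x v. 0" "{}"]) auto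

lemma Cc1_sum:
  assumes "finite I" "\<And>i. i \<in> I \<Longrightarrow> \<psi> i \<in> Cc1 \<Omega>"
  shows "(\<lambda>x. \<Sum>i\<in>I. \<psi> i x) \<in> Cc1 \<Omega>"
  using assms by (induction I rule: finite_induct) (auto intro: Cc1_add zero_in_Cc1)

lemma Cc1_compose:
  fixes \<psi> :: "plane \<Rightarrow> real"
  assumes "\<And>t. (f has_real_derivative f' t) (at t)" "continuous_on UNIV f'" "f 0 = 0"
    and "\<psi> \<in> Cc1 \<Omega>"
  shows "(\<lambda>x. f (\<psi> x)) \<in> Cc1 \<Omega>"
proof -
  have der: "((\<lambda>x. f (\<psi> x)) has_derivative (\<lambda>v. f' (\<psi> x) * derivative_at \<psi> x v)) (at x)" for x
    using diff_chain_at[OF Cc1_has_derivative[OF assms(4)] assms(1)[unfolded has_field_derivative_def]]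
    by (simp add: o_def)
  obtain K where K: "compact K" "K \<subseteq> \<Omega>" "\<And>x. x \<notin> K \<Longrightarrow> \<psi> x = 0"
    using Cc1_support[OF assms(4)] by metis
  show ?thesis
    by (intro Cc1_I[OF der _ K(1,2)] continuous_intros Cc1_continuous_derivative[OF assms(4)]
        continuous_on_compose2[OF assms(2) Cc1_continuous[OF assms(4)]]) (simp_all add: K(3) assms(3))
qed

text \<open>Finitely many bumps inside \<open>\<Omega>\<close> cover \<open>K\<close>, so their sum has a positive minimum on \<open>K\<close>;
  composing the rescaled sum with the step makes it constantly 1 there.\<close>
lemma cutoff_exists:
  assumes "open \<Omega>" "compact K" "K \<subseteq> \<Omega>"
  obtains \<eta> :: "plane \<Rightarrow> real"
  where "\<eta> \<in> Cc1 \<Omega>" "\<And>x. 0 \<le> \<eta> x" "\<And>x. \<eta> x \<le> 1" "\<And>x. x \<in> K \<Longrightarrow> \<eta> x = 1"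
    "\<And>x v. x \<in> K \<Longrightarrow> derivative_at \<eta> x v = 0"
proof -
  have "\<exists>r>0. cball x r \<subseteq> \<Omega>" if "x \<in> K" for x
    using assms that open_contains_cball by blast
  then obtain \<rho> where \<rho>: "\<And>x. x \<in> K \<Longrightarrow> 0 < \<rho> x" "\<And>x. x \<in> K \<Longrightarrow> cball x (\<rho> x) \<subseteq> \<Omega>"
    by metis
  have "K \<subseteq> (\<Union>x\<in>K. ball x (\<rho> x))" using \<rho>(1) by fastforce
  then obtain I where I: "I \<subseteq> K" "finite I" "K \<subseteq> (\<Union>x\<in>I. ball x (\<rho> x))"
    using compactE_image[OF assms(2), of K "\<lambda>x. ball x (\<rho> x)"] by auto
  define S where "S x = (\<Sum>i\<in>I. bump i (\<rho> i) x)" for x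
  have S: "S \<in> Cc1 \<Omega>"
    unfolding S_def[abs_def] using I \<rho> by (intro Cc1_sum bump_in_Cc1) blast+
  have pos: "0 < S x" if x: "x \<in> K" for x
  proof -
    obtain i where i: "i \<in> I" "x \<in> ball i (\<rho> i)" using I(3) x by auto
    then have "0 < bump i (\<rho> i) x" using bump_pos_iff I(1) \<rho>(1) by auto
    then show ?thesis
      unfolding S_def using i I(2) by (intro sum_pos2[of _ i]) (auto simp: bump_nonneg)
  qed
  obtain m where m: "0 < m" "\<And>x. x \<in> K \<Longrightarrow> m \<le> S x"
  proof (cases "K = {}")
    case True
    then show ?thesis using that[of 1] by simp
  next
    case False
    obtain y where "y \<in> K" "\<And>x. x \<in> K \<Longrightarrow> S y \<le> S x"
      using continuous_attains_inf[OF assms(2) False] continuous_on_subset[OF Cc1_continuous[OF S]]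
      by (metis subset_UNIV)
    then show ?thesis using that[of "S y"] pos by auto
  qed
  define \<eta> where "\<eta> x = smooth_step ((1/m) * S x)" for x
  have "((\<lambda>t. smooth_step ((1/m) * t)) has_real_derivative (1/m) * tent ((1/m) * t)) (at t)" for t
    using DERIV_chain2[OF DERIV_smooth_step DERIV_cmult_Id[of "1/m" t UNIV]] by (simp add: mult.commute)
  then have \<eta>: "\<eta> \<in> Cc1 \<Omega>"
    unfolding \<eta>_def[abs_def]
    by (rule Cc1_compose[OF _ _ _ S])
       (auto intro!: continuous_intros continuous_on_compose2[OF continuous_tent] simp: smooth_step_eq_0 less_imp_neq[OF m(1), symmetric])
  have one: "\<eta> x = 1" if "x \<in> K" for x
    using m that by (auto simp: \<eta>_def field_simps intro!: smooth_step_eq_1)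
  \<comment> \<open>The gradient vanishes on \<open>K\<close> because \<open>\<eta>\<close> is maximal there.\<close>
  have "derivative_at \<eta> x v = 0" if "x \<in> K" for x v
  proof -
    have "derivative_at \<eta> x = (\<lambda>v. 0)"
      by (rule differential_zero_maxmin[OF _ open_UNIV Cc1_has_derivative[OF \<eta>]])
         (use one[OF that] smooth_step_bounds in \<open>auto simp: \<eta>_def\<close>)
    then show ?thesis by simp
  qed
  then show ?thesis
    using that[OF \<eta>] one smooth_step_bounds by (auto simp: \<eta>_def)
qed

section \<open>The Cantor ridge function and its derivative\<close>

definition cantor_ridge :: "plane \<Rightarrow> plane \<Rightarrow> plane \<Rightarrow> real" where
  "cantor_ridge a e x = cantor_function ((x - a) \<bullet> e)"

lemma continuous_cantor_ridge: "continuous_on S (cantor_ridge a e)"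
  unfolding cantor_ridge_def[abs_def]
  by (intro continuous_on_compose2[OF continuous_cantor] continuous_intros) auto

text \<open>The density measures \<open>c\<^sub>n' dt\<close> converge weakly to the derivative of the Cantor function. The
  derivative of the ridge function is used only through such limits, so that the measure itself
  need not be constructed.\<close>
lemma cantor_ridge_limit:
  fixes \<psi> :: "plane \<Rightarrow> real"
  assumes "\<psi> \<in> Cc1 UNIV"
  shows "(\<lambda>n. - (v \<bullet> e) * (\<integral>x. cantor_density n ((x - a) \<bullet> e) * \<psi> x \<partial>lborel))
    \<longlonglongrightarrow> (\<integral>x. cantor_ridge a e x * derivative_at \<psi> x v \<partial>lborel)"
proof -
  have meas: "(\<lambda>x. derivative_at \<psi> x v) \<in> borel_measurable borel"
    by (rule borel_measurable_continuous_onI[OF Cc1_continuous_derivative[OF assms]])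
  have "(\<lambda>n. \<integral>x. cantor_approx n ((x - a) \<bullet> e) * derivative_at \<psi> x v \<partial>lborel)
      \<longlonglongrightarrow> (\<integral>x. cantor_ridge a e x * derivative_at \<psi> x v \<partial>lborel)"
  proof (rule integral_dominated_convergence[where w = "\<lambda>x. \<bar>derivative_at \<psi> x v\<bar>"])
    show "(\<lambda>x. cantor_ridge a e x * derivative_at \<psi> x v) \<in> borel_measurable lborel"
      using meas borel_measurable_continuous_onI[OF continuous_cantor_ridge] by simp
    show "(\<lambda>x. cantor_approx n ((x - a) \<bullet> e) * derivative_at \<psi> x v) \<in> borel_measurable lborel" for n
    proof -
      have "continuous_on UNIV (\<lambda>x. cantor_approx n ((x - a) \<bullet> e))"
        by (intro continuous_on_compose2[OF continuous_cantor_approx] continuous_intros) auto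
      then show ?thesis using meas borel_measurable_continuous_onI[of "\<lambda>x. cantor_approx n ((x - a) \<bullet> e)"] by simp
    qed
    show "integrable lborel (\<lambda>x. \<bar>derivative_at \<psi> x v\<bar>)"
      using integrable_mult_Cc1(2)[OF continuous_on_const assms, of 1 v] by simp
    show "AE x in lborel. (\<lambda>n. cantor_approx n ((x - a) \<bullet> e) * derivative_at \<psi> x v)
        \<longlonglongrightarrow> cantor_ridge a e x * derivative_at \<psi> x v"
      unfolding cantor_ridge_def by (intro AE_I2 tendsto_intros cantor_tendsto)
    show "AE x in lborel. norm (cantor_approx n ((x - a) \<bullet> e) * derivative_at \<psi> x v)
        \<le> \<bar>derivative_at \<psi> x v\<bar>" for n
      using cantor_approx_bounds by (intro AE_I2) (simp add: abs_mult mult_left_le_one_le)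
  qed
  then show ?thesis
    using ridge_integration_by_parts[OF DERIV_cantor_approx continuous_cantor_density assms, where v = v]
    by simp
qed

lemma cantor_ridge_divergence_limit:
  assumes "z \<in> Cc1 UNIV"
  shows "(\<lambda>n. - (\<integral>x. cantor_density n ((x - a) \<bullet> e) * (z x \<bullet> e) \<partial>lborel))
    \<longlonglongrightarrow> (\<integral>x. cantor_ridge a e x * divergence z x \<partial>lborel)"
proof -
  have cont: "continuous_on UNIV (\<lambda>x. cantor_density n ((x - a) \<bullet> e))" for n
    by (intro continuous_on_compose2[OF continuous_cantor_density] continuous_intros) auto
  note comp = Cc1_inner_const[OF assms]
  have "(\<lambda>n. \<Sum>b\<in>Basis. - (b \<bullet> e) * (\<integral>x. cantor_density n ((x - a) \<bullet> e) * (z x \<bullet> b) \<partial>lborel))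
    \<longlonglongrightarrow> (\<Sum>b\<in>Basis. \<integral>x. cantor_ridge a e x * (derivative_at z x b \<bullet> b) \<partial>lborel)"
    using cantor_ridge_limit[OF comp(1)] by (intro tendsto_sum) (simp add: comp(2))
  moreover have "(\<Sum>b\<in>Basis. \<integral>x. cantor_ridge a e x * (derivative_at z x b \<bullet> b) \<partial>lborel)
      = (\<integral>x. cantor_ridge a e x * divergence z x \<partial>lborel)"
    using integrable_mult_Cc1(2)[OF continuous_cantor_ridge comp(1)]
    by (simp add: divergence_def sum_distrib_left comp(2))
  moreover have "(\<Sum>b\<in>Basis. - (b \<bullet> e) * (\<integral>x. cantor_density n ((x - a) \<bullet> e) * (z x \<bullet> b) \<partial>lborel))
      = - (\<integral>x. cantor_density n ((x - a) \<bullet> e) * (z x \<bullet> e) \<partial>lborel)" for n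
  proof -
    have "(\<integral>x. cantor_density n ((x - a) \<bullet> e) * (z x \<bullet> e) \<partial>lborel)
        = (\<integral>x. (\<Sum>b\<in>Basis. (b \<bullet> e) * (cantor_density n ((x - a) \<bullet> e) * (z x \<bullet> b))) \<partial>lborel)"
      by (subst euclidean_inner) (simp add: sum_distrib_left mult_ac inner_commute)
    also have "\<dots> = (\<Sum>b\<in>Basis. (b \<bullet> e) * (\<integral>x. cantor_density n ((x - a) \<bullet> e) * (z x \<bullet> b) \<partial>lborel))"
      using integrable_mult_Cc1(1)[OF cont comp(1)] by simp
    finally show ?thesis by (simp add: sum_negf)
  qed
  ultimately show ?thesis by simp
qed

text \<open>The derivative of the ridge function is a positive measure times \<open>e\<close>: pairing it with a field sees
  only the component along \<open>e\<close>, and monotonically so. The minus sign from the integration by parts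
  reverses the inequality.\<close>
lemma cantor_ridge_divergence_mono:
  assumes "z \<in> Cc1 UNIV" "w \<in> Cc1 UNIV" "AE x in lborel. w x \<bullet> e \<le> z x \<bullet> e"
  shows "(\<integral>x. cantor_ridge a e x * divergence z x \<partial>lborel)
       \<le> (\<integral>x. cantor_ridge a e x * divergence w x \<partial>lborel)"
proof (rule LIMSEQ_le[OF cantor_ridge_divergence_limit[OF assms(1)] cantor_ridge_divergence_limit[OF assms(2)]],
    intro exI allI impI)
  fix n
  have cont: "continuous_on UNIV (\<lambda>x. cantor_density n ((x - a) \<bullet> e))"
    by (intro continuous_on_compose2[OF continuous_cantor_density] continuous_intros) auto
  have "(\<integral>x. cantor_density n ((x - a) \<bullet> e) * (w x \<bullet> e) \<partial>lborel)
      \<le> (\<integral>x. cantor_density n ((x - a) \<bullet> e) * (z x \<bullet> e) \<partial>lborel)"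
    by (rule integral_mono_AE)
       (use assms(3) in \<open>auto intro!: integrable_mult_Cc1[OF cont] Cc1_inner_const assms(1,2)
         mult_left_mono cantor_density_nonneg elim!: eventually_mono\<close>)
  then show "- (\<integral>x. cantor_density n ((x - a) \<bullet> e) * (z x \<bullet> e) \<partial>lborel)
      \<le> - (\<integral>x. cantor_density n ((x - a) \<bullet> e) * (w x \<bullet> e) \<partial>lborel)" by simp
qed

lemma integral_lebesgue_on_eq:
  fixes g :: "plane \<Rightarrow> real"
  assumes "open \<Omega>" "g \<in> borel_measurable borel" "\<And>x. x \<notin> \<Omega> \<Longrightarrow> g x = 0"
  shows "(\<integral>x. g x \<partial>lebesgue_on \<Omega>) = (\<integral>x. g x \<partial>lborel)"
proof -
  have "(\<lambda>x. indicator \<Omega> x *\<^sub>R g x) = g" using assms(3) by (auto simp: indicator_def fun_eq_iff)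
  then have "(\<integral>x. g x \<partial>lebesgue_on \<Omega>) = (\<integral>x. g x \<partial>lebesgue)"
    using assms(1) by (subst integral_restrict_space) auto
  also have "\<dots> = (\<integral>x. g x \<partial>lborel)"
    by (rule integral_completion) (use assms(2) in simp)
  finally show ?thesis .
qed

lemma continuous_divergence: "z \<in> Cc1 \<Omega> \<Longrightarrow> continuous_on UNIV (divergence z)"
  unfolding divergence_def[abs_def] by (intro continuous_intros Cc1_continuous_derivative)

lemma divergence_outside:
  assumes "z \<in> Cc1 \<Omega>" "x \<notin> \<Omega>" shows "divergence z x = 0"
proof -
  obtain K where "K \<subseteq> \<Omega>" "\<And>x v. x \<notin> K \<Longrightarrow> derivative_at z x v = 0"
    using Cc1_support[OF assms(1)] by metis
  then have "\<And>v. derivative_at z x v = 0" using assms(2) by blast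
  then show ?thesis by (simp add: divergence_def)
qed

lemma integral_divergence_lebesgue_on:
  assumes "open \<Omega>" "z \<in> Cc1 \<Omega>" "continuous_on UNIV u"
  shows "(\<integral>x. u x * divergence z x \<partial>lebesgue_on \<Omega>) = (\<integral>x. u x * divergence z x \<partial>lborel)"
  by (rule integral_lebesgue_on_eq[OF assms(1)])
     (use assms in \<open>auto intro!: borel_measurable_continuous_onI continuous_intros continuous_divergence
        simp: divergence_outside\<close>)

text \<open>The admissibility constraint holds almost everywhere in the domain, whereas the pairings are
  integrals over the whole plane.\<close>
lemma AE_lborel_outside:
  assumes "open \<Omega>" "AE x in lebesgue_on \<Omega>. P x" "\<And>x. x \<notin> \<Omega> \<Longrightarrow> P x"
  shows "AE x in lborel. P x"
proof -
  have "AE x in lebesgue. x \<in> \<Omega> \<longrightarrow> P x"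
    using assms(1,2) by (subst (asm) AE_restrict_space_iff) auto
  then show ?thesis using assms(3) by (auto simp: AE_completion_iff elim!: eventually_mono)
qed

section \<open>The derivative of the ridge function is singular\<close>

text \<open>Absolute continuity with respect to Lebesgue measure is expressed by \<open>null\<close>; \<open>k \<mu>\<close> plays the role of
  the derivative in direction \<open>v\<close>. With \<open>\<mu>\<close> the Lebesgue measure on the domain this excludes weak
  derivatives, and with \<open>\<mu> = \<bar>Du\<bar>\<close> it excludes a total variation measure without singular part.

  A nonnegative test function \<open>\<eta>\<close> is split into \<open>\<psi>\<^sub>n = \<theta>\<^sub>n \<eta>\<close> and \<open>\<tau>\<^sub>n = (1 - \<theta>\<^sub>n) \<eta>\<close>. The late
  densities do not see \<open>\<tau>\<^sub>n\<close>, and dominated convergence disposes of \<open>\<psi>\<^sub>n\<close>. So the densities pair to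
  0 with every such \<open>\<eta>\<close>, which is independent of \<open>v\<close>, and \<open>v\<close> may be replaced by \<open>e\<close>. For a radial
  bump around \<open>a\<close> this is absurd: its derivative along \<open>e\<close> is negative where \<open>c > 0\<close> in its ball, and
  \<open>c = 0\<close> elsewhere.\<close>
lemma cantor_ridge_not_absolutely_continuous:
  fixes \<mu> :: "plane measure" and k :: "plane \<Rightarrow> real"
  assumes "open \<Omega>" "a \<in> \<Omega>" "v \<bullet> e \<noteq> 0"
    and null: "\<And>P. (AE x in lborel. P x) \<Longrightarrow> (AE x in \<mu>. P x)"
    and meas: "\<And>g :: plane \<Rightarrow> real. g \<in> borel_measurable borel \<Longrightarrow> g \<in> borel_measurable \<mu>"
    and k: "integrable \<mu> k"
    and rep: "\<And>\<psi>. \<psi> \<in> Cc1 \<Omega> \<Longrightarrow>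
      (\<integral>x. cantor_ridge a e x * derivative_at \<psi> x v \<partial>lborel) = - (\<integral>x. \<psi> x * k x \<partial>\<mu>)"
  shows False
proof -
  have vanish: "(\<lambda>n. \<integral>x. cantor_density n ((x - a) \<bullet> e) * \<eta> x \<partial>lborel) \<longlonglongrightarrow> 0"
    if \<eta>: "\<eta> \<in> Cc1 \<Omega>" and pos: "\<And>x. 0 \<le> \<eta> x" for \<eta> :: "plane \<Rightarrow> real"
  proof -
    have \<eta>': "\<eta> \<in> Cc1 UNIV" using Cc1_mono[OF _ \<eta>] by simp
    define \<psi> where "\<psi> n x = cantor_cutoff n ((x - a) \<bullet> e) *\<^sub>R \<eta> x" for n x
    define \<tau> where "\<tau> n x = (1 - cantor_cutoff n ((x - a) \<bullet> e)) *\<^sub>R \<eta> x" for n x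
    have contd: "continuous_on UNIV (\<lambda>x. cutoff_derivative n ((x - a) \<bullet> e) * (w \<bullet> e))"
      "continuous_on UNIV (\<lambda>x. (- cutoff_derivative n ((x - a) \<bullet> e)) * (w \<bullet> e))" for n w
      by (intro continuous_intros continuous_on_compose2[OF continuous_cutoff_derivative]; simp)+
    have \<psi>: "\<psi> n \<in> Cc1 \<Omega>" for n
      unfolding \<psi>_def[abs_def]
      by (rule Cc1_mult(1)[OF has_derivative_ridge[OF DERIV_cantor_cutoff] contd(1) \<eta>])
    have "((\<lambda>t. 1 - cantor_cutoff n t) has_real_derivative - cutoff_derivative n t) (at t)" for n t
      by (auto intro!: derivative_eq_intros DERIV_cantor_cutoff)
    from has_derivative_ridge[of "\<lambda>t. 1 - cantor_cutoff n t" for n, OF this]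
    have \<tau>: "\<tau> n \<in> Cc1 \<Omega>" for n
      unfolding \<tau>_def[abs_def] by (rule Cc1_mult(1)[OF _ contd(2) \<eta>])
    have \<tau>': "\<tau> n \<in> Cc1 UNIV" for n using Cc1_mono[OF _ \<tau>] by simp
    have split: "derivative_at \<eta> x v = derivative_at (\<tau> n) x v + derivative_at (\<psi> n) x v" for n x
    proof -
      have "\<eta> = (\<lambda>x. \<tau> n x + \<psi> n x)" by (simp add: \<tau>_def \<psi>_def fun_eq_iff algebra_simps)
      then show ?thesis using Cc1_add(2)[OF \<tau> \<psi>] by metis
    qed
    \<comment> \<open>The late Cantor densities live where the cutoff equals 1.\<close>
    have "(\<integral>x. cantor_ridge a e x * derivative_at (\<tau> n) x v \<partial>lborel) = 0" for n
    proof (rule LIMSEQ_unique[OF cantor_ridge_limit[OF \<tau>']], rule tendsto_eventually)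
      have zero: "cantor_density m ((x - a) \<bullet> e) * \<tau> n x = 0" if "n \<le> m" for m x
        using cantor_cutoff_eq_1[of n "m - n" "(x - a) \<bullet> e"] that by (auto simp: \<tau>_def)
      show "\<forall>\<^sub>F m in sequentially.
          - (v \<bullet> e) * (\<integral>x. cantor_density m ((x - a) \<bullet> e) * \<tau> n x \<partial>lborel) = 0"
        by (intro eventually_sequentiallyI[of n]) (simp add: zero)
    qed
    note \<tau>_zero = this
    have same: "(\<integral>x. cantor_ridge a e x * derivative_at \<eta> x v \<partial>lborel)
        = - (\<integral>x. \<psi> n x * k x \<partial>\<mu>)" for n
    proof -
      have "(\<integral>x. cantor_ridge a e x * derivative_at \<eta> x v \<partial>lborel)
          = (\<integral>x. cantor_ridge a e x * derivative_at (\<tau> n) x v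
               + cantor_ridge a e x * derivative_at (\<psi> n) x v \<partial>lborel)"
        unfolding split[of _ n] distrib_left ..
      also have "\<dots> = (\<integral>x. cantor_ridge a e x * derivative_at (\<psi> n) x v \<partial>lborel)"
        using Bochner_Integration.integral_add[OF integrable_mult_Cc1(2)[OF continuous_cantor_ridge \<tau>]
            integrable_mult_Cc1(2)[OF continuous_cantor_ridge \<psi>]] \<tau>_zero by simp
      finally show ?thesis by (simp only: rep[OF \<psi>])
    qed
    have \<psi>_pos: "0 \<le> \<psi> n x" for n x
      unfolding \<psi>_def real_scaleR_def
      by (rule mult_nonneg_nonneg[OF conjunct1[OF cantor_cutoff_bounds] pos])
    have \<psi>_le: "\<psi> n x \<le> \<eta> x" for n x
      unfolding \<psi>_def real_scaleR_def
      using cantor_cutoff_bounds by (intro mult_left_le_one_le pos) blast+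
    have cont\<psi>: "continuous_on UNIV (\<psi> n)" for n by (rule Cc1_continuous[OF \<psi>])
    have int\<psi>: "integrable lborel (\<psi> n)" for n
      using integrable_mult_Cc1(1)[OF continuous_on_const \<psi>, of 1] by simp
    \<comment> \<open>Up to a factor, the mass of \<open>\<psi> n\<close> is the pairing of the small primitive of the cutoff
      with the derivative of \<open>\<eta>\<close>.\<close>
    have "(\<lambda>n. \<integral>x. norm (\<psi> n x) \<partial>lborel) \<longlonglongrightarrow> 0"
    proof (rule Lim_null_comparison)
      define C where "C = (\<integral>x. \<bar>derivative_at \<eta> x v\<bar> \<partial>lborel)"
      show "\<forall>\<^sub>F n in sequentially. norm (\<integral>x. norm (\<psi> n x) \<partial>lborel) \<le> (2/3) ^ n * (5/4 * C / \<bar>v \<bullet> e\<bar>)"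
      proof (intro always_eventually allI)
        fix n
        have contP: "continuous_on UNIV (\<lambda>x. cutoff_primitive n ((x - a) \<bullet> e))"
          by (intro continuous_on_compose2[OF DERIV_continuous_on[OF DERIV_cutoff_primitive]]
              continuous_intros) simp
        have int: "integrable lborel (\<lambda>x. cutoff_primitive n ((x - a) \<bullet> e) * derivative_at \<eta> x v)"
          by (rule integrable_mult_Cc1(2)[OF contP \<eta>])
        have intD: "integrable lborel (\<lambda>x. derivative_at \<eta> x v)"
          using integrable_mult_Cc1(2)[OF continuous_on_const \<eta>, of 1] by simp
        have norm_\<psi>: "(\<integral>x. norm (\<psi> n x) \<partial>lborel) = (\<integral>x. \<psi> n x \<partial>lborel)"
          by (simp only: real_norm_def abs_of_nonneg[OF \<psi>_pos])
        have "0 \<le> (\<integral>x. \<psi> n x \<partial>lborel)" by (intro integral_nonneg_AE AE_I2 \<psi>_pos)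
        then have "\<bar>v \<bullet> e\<bar> * (\<integral>x. norm (\<psi> n x) \<partial>lborel)
            = \<bar>- (v \<bullet> e) * (\<integral>x. \<psi> n x \<partial>lborel)\<bar>"
          unfolding norm_\<psi> by (simp add: abs_mult)
        also have "- (v \<bullet> e) * (\<integral>x. \<psi> n x \<partial>lborel)
            = (\<integral>x. cutoff_primitive n ((x - a) \<bullet> e) * derivative_at \<eta> x v \<partial>lborel)"
          unfolding \<psi>_def real_scaleR_def
          by (rule ridge_integration_by_parts[OF DERIV_cutoff_primitive continuous_cantor_cutoff \<eta>', symmetric])
        also have "\<bar>\<integral>x. cutoff_primitive n ((x - a) \<bullet> e) * derivative_at \<eta> x v \<partial>lborel\<bar>
            \<le> (\<integral>x. \<bar>cutoff_primitive n ((x - a) \<bullet> e) * derivative_at \<eta> x v\<bar> \<partial>lborel)"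
          by (rule integral_abs_bound)
        also have "\<dots> \<le> (\<integral>x. (2/3) ^ n * (5/4) * \<bar>derivative_at \<eta> x v\<bar> \<partial>lborel)"
        proof (rule integral_mono)
          show "integrable lborel (\<lambda>x. \<bar>cutoff_primitive n ((x - a) \<bullet> e) * derivative_at \<eta> x v\<bar>)"
            using int by (rule integrable_abs)
          show "integrable lborel (\<lambda>x. (2/3) ^ n * (5/4) * \<bar>derivative_at \<eta> x v\<bar>)"
            using intD by (intro integrable_mult_right integrable_abs)
          show "\<bar>cutoff_primitive n ((x - a) \<bullet> e) * derivative_at \<eta> x v\<bar>
              \<le> (2/3) ^ n * (5/4) * \<bar>derivative_at \<eta> x v\<bar>" for x
            unfolding abs_mult by (rule mult_right_mono[OF cutoff_primitive_bound abs_ge_zero])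
        qed
        also have "\<dots> = (2/3) ^ n * (5/4) * C" by (simp add: C_def)
        finally show "norm (\<integral>x. norm (\<psi> n x) \<partial>lborel) \<le> (2/3) ^ n * (5/4 * C / \<bar>v \<bullet> e\<bar>)"
          using assms(3) by (simp add: field_simps)
      qed
      show "(\<lambda>n. (2/3) ^ n * (5/4 * C / \<bar>v \<bullet> e\<bar>)) \<longlonglongrightarrow> 0"
        by (intro tendsto_mult_left_zero LIMSEQ_power_zero) simp
    qed
    from tendsto_L1_AE_subseq[OF int\<psi> this] obtain r where
      "strict_mono r" and ae: "AE x in lborel. (\<lambda>n. \<psi> (r n) x) \<longlonglongrightarrow> 0" by blast
    obtain M where M: "\<And>x. \<eta> x \<le> M"
    proof -
      obtain K where K: "compact K" "\<And>x. x \<notin> K \<Longrightarrow> \<eta> x = 0"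
        using Cc1_support[OF \<eta>] by metis
      have "bounded (\<eta> ` K)"
        using K(1) continuous_on_subset[OF Cc1_continuous[OF \<eta>]]
        by (intro compact_imp_bounded compact_continuous_image) auto
      then obtain M where "\<And>x. x \<in> K \<Longrightarrow> \<bar>\<eta> x\<bar> \<le> M" by (auto simp: bounded_iff)
      then have "\<eta> x \<le> max 0 M" for x using K(2)[of x] by (cases "x \<in> K") force+
      then show ?thesis by (rule that)
    qed
    have "(\<lambda>n. \<integral>x. \<psi> (r n) x * k x \<partial>\<mu>) \<longlonglongrightarrow> (\<integral>x. 0 \<partial>\<mu>)"
    proof (rule integral_dominated_convergence[where w = "\<lambda>x. M * \<bar>k x\<bar>"])
      show "(\<lambda>x. \<psi> (r n) x * k x) \<in> borel_measurable \<mu>" for n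
        using k meas[OF borel_measurable_continuous_onI[OF cont\<psi>]] by measurable
      show "integrable \<mu> (\<lambda>x. M * \<bar>k x\<bar>)" using k by simp
      show "AE x in \<mu>. (\<lambda>n. \<psi> (r n) x * k x) \<longlonglongrightarrow> 0"
        using null[OF ae] by (auto elim!: eventually_mono intro: tendsto_mult_left_zero)
      show "AE x in \<mu>. norm (\<psi> (r n) x * k x) \<le> M * \<bar>k x\<bar>" for n
        using \<psi>_pos order_trans[OF \<psi>_le M]
        by (intro AE_I2) (auto simp: abs_mult intro!: mult_right_mono)
    qed simp
    from tendsto_minus[OF this]
    have "(\<integral>x. cantor_ridge a e x * derivative_at \<eta> x v \<partial>lborel) = 0"
      unfolding same[symmetric] by (simp add: LIMSEQ_const_iff)
    then have "(\<lambda>n. - (v \<bullet> e) * (\<integral>x. cantor_density n ((x - a) \<bullet> e) * \<eta> x \<partial>lborel)) \<longlonglongrightarrow> 0"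
      using cantor_ridge_limit[OF \<eta>', of v e a] by simp
    from tendsto_mult_left[OF this, of "- 1 / (v \<bullet> e)"] show ?thesis using assms(3) by simp
  qed
  obtain \<rho> where \<rho>: "0 < \<rho>" "cball a \<rho> \<subseteq> \<Omega>" using assms(1,2) open_contains_cball by blast
  have b: "bump a \<rho> \<in> Cc1 \<Omega>" by (rule bump_in_Cc1[OF \<rho>])
  then have b': "bump a \<rho> \<in> Cc1 UNIV" using Cc1_mono[OF _ b] by simp
  let ?g = "\<lambda>x. - (cantor_ridge a e x * derivative_at (bump a \<rho>) x e)"
  have "(\<integral>x. cantor_ridge a e x * derivative_at (bump a \<rho>) x e \<partial>lborel) = 0"
    using LIMSEQ_unique[OF cantor_ridge_limit[OF b', of e e a]
        tendsto_mult_right_zero[OF vanish[OF b bump_nonneg]]] by simp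
  then have int_g: "(\<integral>x. ?g x \<partial>lborel) = 0" by simp
  have g_nonneg: "0 \<le> ?g x" for x
    using cantor_eq_0[of "(x - a) \<bullet> e"] cantor_bounds(1)[of "(x - a) \<bullet> e"]
    by (cases "(x - a) \<bullet> e \<le> 0") (auto simp: cantor_ridge_def derivative_at_bump intro!: mult_nonneg_nonneg)
  have "integrable lborel ?g"
    using integrable_mult_Cc1(2)[OF continuous_cantor_ridge b] by simp
  then have "(\<integral>x. ?g x \<partial>lborel) = 0 \<longleftrightarrow> (AE x in lborel. ?g x = 0)"
    by (rule integral_nonneg_eq_0_iff_AE) (rule AE_I2, rule g_nonneg)
  then have ae: "AE x in lborel. ?g x = 0" using int_g by (rule iffD1)
  define U where "U = {x. 0 < (x - a) \<bullet> e} \<inter> ball a \<rho>"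
  have "AE x in lborel. x \<notin> U"
    using ae
  proof eventually_elim
    fix x assume "?g x = 0"
    show "x \<notin> U"
    proof
      assume x: "x \<in> U"
      then have "0 < cantor_function ((x - a) \<bullet> e)" by (intro cantor_pos) (simp add: U_def)
      moreover have "0 < \<rho>\<^sup>2 - (x - a) \<bullet> (x - a)" using x inside_ball_iff[OF \<rho>(1)] by (simp add: U_def)
      ultimately show False using x \<open>?g x = 0\<close>
        by (auto simp: U_def cantor_ridge_def derivative_at_bump)
    qed
  qed
  moreover have "open U"
    unfolding U_def by (intro open_Int open_ball open_Collect_less continuous_intros)
  ultimately have "U \<in> null_sets lborel"
    by (auto simp: AE_iff_null_sets)
  then have "U = {}"
    using \<open>open U\<close> open_not_negligible[of U] null_sets_completionI[of U lborel]
    by (auto simp: negligible_iff_null_sets)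
  moreover have "a + (\<rho> / (2 * norm e)) *\<^sub>R e \<in> U"
  proof -
    have "e \<noteq> 0" using assms(3) by auto
    then show ?thesis using \<rho>(1) by (simp add: U_def dist_norm)
  qed
  ultimately show False by simp
qed

section \<open>Continuous functions: approximate limits and traces\<close>

lemma approx_limit_continuous:
  assumes "continuous_on UNIV u" "open \<Omega>"
  shows "approx_limit \<Omega> u x (u x)"
  unfolding approx_limit_def
proof (rule tendstoI)
  fix \<epsilon> :: real assume "0 < \<epsilon>"
  then obtain \<delta> where \<delta>: "0 < \<delta>" "\<And>y. dist y x < \<delta> \<Longrightarrow> dist (u y) (u x) < \<epsilon> / 2"
    using assms(1) unfolding continuous_on_iff by (metis UNIV_I half_gt_zero)
  have "\<bar>(\<integral>y. \<bar>u y - u x\<bar> \<partial>lebesgue_on (ball x r \<inter> \<Omega>)) / measure lebesgue (ball x r \<inter> \<Omega>)\<bar> < \<epsilon>"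
    if r: "0 < r" "r < \<delta>" for r
  proof -
    let ?S = "ball x r \<inter> \<Omega>"
    have S: "?S \<in> lmeasurable"
      using assms(2) by (intro bounded_set_imp_lmeasurable) auto
    interpret finite_measure "lebesgue_on ?S" by (rule finite_measure_lebesgue_on[OF S])
    have small: "\<bar>u y - u x\<bar> \<le> \<epsilon> / 2" if "y \<in> ?S" for y
      using \<delta>(2)[of y] that r by (auto simp: dist_real_def dist_commute intro: less_imp_le)
    have "(\<lambda>y. \<bar>u y - u x\<bar>) \<in> borel_measurable (lebesgue_on ?S)"
      using S by (intro continuous_imp_measurable_on_sets_lebesgue continuous_intros
          continuous_on_subset[OF assms(1)]) auto
    then have int: "integrable (lebesgue_on ?S) (\<lambda>y. \<bar>u y - u x\<bar>)"
      using small by (intro integrable_const_bound[where B = "\<epsilon> / 2"] AE_I2) auto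
    have "(\<integral>y. \<bar>u y - u x\<bar> \<partial>lebesgue_on ?S) \<le> (\<integral>y. \<epsilon> / 2 \<partial>lebesgue_on ?S)"
      by (rule integral_mono[OF int]) (use small in auto)
    also have "\<dots> = \<epsilon> / 2 * measure lebesgue ?S"
      using S by (simp add: measure_restrict_space fmeasurableD)
    finally have le: "(\<integral>y. \<bar>u y - u x\<bar> \<partial>lebesgue_on ?S) \<le> \<epsilon> / 2 * measure lebesgue ?S" .
    have "0 \<le> (\<integral>y. \<bar>u y - u x\<bar> \<partial>lebesgue_on ?S)" by simp
    show ?thesis
    proof (cases "measure lebesgue ?S = 0")
      case True
      then show ?thesis using \<open>0 < \<epsilon>\<close> by simp
    next
      case False
      then have "0 < measure lebesgue ?S" by (simp add: zero_less_measure_iff)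
      then have "(\<integral>y. \<bar>u y - u x\<bar> \<partial>lebesgue_on ?S) / measure lebesgue ?S \<le> \<epsilon> / 2"
        using le by (simp add: field_simps)
      then have "(\<integral>y. \<bar>u y - u x\<bar> \<partial>lebesgue_on ?S) / measure lebesgue ?S < \<epsilon>"
        by (rule le_less_trans) (use \<open>0 < \<epsilon>\<close> in simp)
      then show ?thesis by simp
    qed
  qed
  then show "\<forall>\<^sub>F r in at_right 0. dist ((\<integral>y. \<bar>u y - u x\<bar> \<partial>lebesgue_on (ball x r \<inter> \<Omega>))
      / measure lebesgue (ball x r \<inter> \<Omega>)) 0 < \<epsilon>"
    using \<delta>(1) by (auto simp: eventually_at_right dist_real_def intro!: exI[of _ \<delta>])
qed

lemma hausdorff1_empty: "hausdorff1 {} = 0"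
proof -
  have "(INF C \<in> {C :: nat \<Rightarrow> plane set. {} \<subseteq> (\<Union>n. C n) \<and> (\<forall>n. bounded (C n) \<and> diameter (C n) \<le> \<delta>)}.
          (\<Sum>n. ennreal (diameter (C n)))) \<le> 0" if "0 < \<delta>" for \<delta> :: real
    using that by (intro INF_lower2[of "\<lambda>n. {}"]) auto
  then show ?thesis unfolding hausdorff1_def by (intro antisym SUP_least) auto
qed

lemma has_trace_continuous:
  assumes "continuous_on UNIV u" "open \<Omega>"
  shows "has_trace \<Omega> u u"
  using approx_limit_continuous[OF assms] by (simp add: has_trace_def hausdorff1_empty)

lemma integrable_continuous_bounded:
  fixes u :: "plane \<Rightarrow> real"
  assumes "continuous_on UNIV u" "\<And>x. \<bar>u x\<bar> \<le> M" "open \<Omega>" "bounded \<Omega>"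
  shows "integrable (lebesgue_on \<Omega>) u"
proof -
  have \<Omega>: "\<Omega> \<in> lmeasurable" using assms(3,4) by (intro bounded_set_imp_lmeasurable) auto
  interpret finite_measure "lebesgue_on \<Omega>" by (rule finite_measure_lebesgue_on[OF \<Omega>])
  have "u \<in> borel_measurable (lebesgue_on \<Omega>)"
    using \<Omega> by (intro continuous_imp_measurable_on_sets_lebesgue continuous_on_subset[OF assms(1)]) auto
  then show ?thesis using assms(2) by (intro integrable_const_bound[where B = M] AE_I2) auto
qed

section \<open>The ridge function is of least gradient\<close>

text \<open>A cutoff that equals 1 on the domain, times a large multiple of \<open>-z\<^sub>0\<close>, lies below every field of
  norm at most 1 in direction \<open>e\<close>.\<close>
lemma cantor_ridge_BV:
  assumes "open \<Omega>" "bounded \<Omega>" "z\<^sub>0 \<bullet> e = 1"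
  shows "cantor_ridge a e \<in> BV \<Omega>"
proof -
  have "compact (closure \<Omega>)" using assms(2) by simp
  then obtain \<eta> :: "plane \<Rightarrow> real" where \<eta>: "\<eta> \<in> Cc1 UNIV" "\<And>x. 0 \<le> \<eta> x" "\<And>x. x \<in> closure \<Omega> \<Longrightarrow> \<eta> x = 1"
    by (rule cutoff_exists[OF open_UNIV _ subset_UNIV]) blast
  define w where "w x = \<eta> x *\<^sub>R (- (norm e *\<^sub>R z\<^sub>0))" for x
  have w: "w \<in> Cc1 UNIV" unfolding w_def[abs_def] by (rule Cc1_scaleR_const(1)[OF \<eta>(1)])
  have w_e: "w x \<bullet> e = - \<eta> x * norm e" for x using assms(3) by (simp add: w_def)
  have "total_variation \<Omega> (cantor_ridge a e) \<le> ereal (\<integral>x. cantor_ridge a e x * divergence w x \<partial>lborel)"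
    unfolding total_variation_def
  proof (rule SUP_least, clarsimp)
    fix z :: "plane \<Rightarrow> plane" assume z: "z \<in> Cc1 \<Omega>" "\<forall>x. norm (z x) \<le> 1"
    have "w x \<bullet> e \<le> z x \<bullet> e" for x
    proof (cases "x \<in> \<Omega>")
      case True
      then have "\<eta> x = 1" using \<eta>(3) closure_subset by blast
      moreover have "\<bar>z x \<bullet> e\<bar> \<le> 1 * norm e"
        by (rule order_trans[OF Cauchy_Schwarz_ineq2]) (use z(2) in \<open>intro mult_right_mono; simp\<close>)
      ultimately show ?thesis by (simp add: w_e)
    next
      case False
      then have "z x = 0" using Cc1_support[OF z(1)] by (metis subsetD)
      then show ?thesis using \<eta>(2) by (simp add: w_e)
    qed
    then have "(\<integral>x. cantor_ridge a e x * divergence z x \<partial>lborel)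
        \<le> (\<integral>x. cantor_ridge a e x * divergence w x \<partial>lborel)"
      by (intro cantor_ridge_divergence_mono[OF Cc1_mono[OF _ z(1)] w]) auto
    then show "(\<integral>x. cantor_ridge a e x * divergence z x \<partial>lebesgue_on \<Omega>)
        \<le> (\<integral>x. cantor_ridge a e x * divergence w x \<partial>lborel)"
      by (simp add: integral_divergence_lebesgue_on[OF assms(1) z(1) continuous_cantor_ridge])
  qed
  moreover have "integrable (lebesgue_on \<Omega>) (cantor_ridge a e)"
    by (rule integrable_continuous_bounded[OF continuous_cantor_ridge _ assms(1,2), where M = 1])
       (use cantor_bounds in \<open>simp add: cantor_ridge_def\<close>)
  ultimately show ?thesis unfolding BV_def by (auto intro: le_less_trans)
qed

text \<open>The calibration argument. For a norm \<open>\<phi>\<close> the first hypothesis on \<open>\<phi>\<close> is the dual form of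
  \<open>\<phi> e \<le> 1\<close>; the second says that \<open>z\<^sub>0\<close> may be multiplied by a cutoff and remains admissible.\<close>
lemma cantor_ridge_least_gradient:
  assumes "open \<Omega>" "bounded \<Omega>" "z\<^sub>0 \<bullet> e = 1"
    and lower: "\<And>z. dual_integrand \<phi> z \<le> 1 \<Longrightarrow> - 1 \<le> z \<bullet> e"
    and calibration: "\<And>t. 0 \<le> t \<Longrightarrow> t \<le> 1 \<Longrightarrow> dual_integrand \<phi> (t *\<^sub>R (- z\<^sub>0)) \<le> 1"
  shows "least_gradient \<Omega> \<phi> (cantor_ridge a e)"
  unfolding least_gradient_def
proof (intro conjI ballI impI)
  let ?u = "cantor_ridge a e"
  show "?u \<in> BV \<Omega>" by (rule cantor_ridge_BV[OF assms(1-3)])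
  fix v assume v: "v \<in> BV \<Omega>" "compactly_supported_in \<Omega> v"
  obtain K where K: "compact K" "K \<subseteq> \<Omega>" "AE x in lebesgue_on \<Omega>. x \<notin> K \<longrightarrow> v x = 0"
    using v(2) unfolding compactly_supported_in_def by blast
  show "phi_variation \<Omega> \<phi> ?u \<le> phi_variation \<Omega> \<phi> (\<lambda>x. ?u x + v x)"
    unfolding phi_variation_def[of \<Omega> \<phi> ?u]
  proof (rule SUP_least, clarify)
    fix z :: "plane \<Rightarrow> plane"
    assume z: "z \<in> Cc1 \<Omega>" "AE x in lebesgue_on \<Omega>. dual_integrand \<phi> (z x) \<le> 1"
    obtain L where L: "compact L" "L \<subseteq> \<Omega>" "\<And>x. x \<notin> L \<Longrightarrow> z x = 0"
      using Cc1_support[OF z(1)] by metis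
    obtain \<eta> :: "plane \<Rightarrow> real" where \<eta>: "\<eta> \<in> Cc1 \<Omega>" "\<And>x. 0 \<le> \<eta> x" "\<And>x. \<eta> x \<le> 1"
      "\<And>x. x \<in> K \<union> L \<Longrightarrow> \<eta> x = 1" "\<And>x v. x \<in> K \<union> L \<Longrightarrow> derivative_at \<eta> x v = 0"
      by (rule cutoff_exists[OF assms(1) compact_Un[OF K(1) L(1)] Un_least[OF K(2) L(2)]]) blast
    define w where "w x = \<eta> x *\<^sub>R (- z\<^sub>0)" for x
    have w: "w \<in> Cc1 \<Omega>" unfolding w_def[abs_def] by (rule Cc1_scaleR_const(1)[OF \<eta>(1)])
    \<comment> \<open>This is why the perturbation \<open>v\<close> does not contribute.\<close>
    have div_w: "divergence w x = 0" if "x \<in> K" for x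
      using Cc1_scaleR_const(2)[OF \<eta>(1), of "- z\<^sub>0"] \<eta>(5) that
      by (simp add: divergence_def w_def[abs_def])
    have w_e: "w x \<bullet> e = - \<eta> x" for x using assms(3) by (simp add: w_def)
    have "AE x in lborel. x \<in> \<Omega> \<longrightarrow> - 1 \<le> z x \<bullet> e"
      by (rule AE_lborel_outside[OF assms(1)]) (use z(2) lower in \<open>auto elim!: eventually_mono\<close>)
    then have "AE x in lborel. w x \<bullet> e \<le> z x \<bullet> e"
    proof eventually_elim
      fix x assume *: "x \<in> \<Omega> \<longrightarrow> - 1 \<le> z x \<bullet> e"
      show "w x \<bullet> e \<le> z x \<bullet> e"
        using * L(2,3) \<eta>(2,4) by (cases "x \<in> L") (auto simp: w_e)
    qed
    then have "(\<integral>x. ?u x * divergence z x \<partial>lborel) \<le> (\<integral>x. ?u x * divergence w x \<partial>lborel)"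
      by (rule cantor_ridge_divergence_mono[OF Cc1_mono[OF subset_UNIV z(1)] Cc1_mono[OF subset_UNIV w]])
    then have "(\<integral>x. ?u x * divergence z x \<partial>lebesgue_on \<Omega>) \<le> (\<integral>x. ?u x * divergence w x \<partial>lebesgue_on \<Omega>)"
      by (simp add: integral_divergence_lebesgue_on[OF assms(1) _ continuous_cantor_ridge] z(1) w)
    also have "\<dots> = (\<integral>x. (?u x + v x) * divergence w x \<partial>lebesgue_on \<Omega>)"
    proof (rule integral_cong_AE)
      have \<Omega>: "\<Omega> \<in> sets lebesgue" using assms(1) by simp
      have m: "divergence w \<in> borel_measurable (lebesgue_on \<Omega>)" "?u \<in> borel_measurable (lebesgue_on \<Omega>)"
        using \<Omega> by (auto intro!: continuous_imp_measurable_on_sets_lebesgue continuous_cantor_ridge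
            continuous_on_subset[OF continuous_divergence[OF w]])
      have "v \<in> borel_measurable (lebesgue_on \<Omega>)" using v(1) by (auto simp: BV_def)
      then show "(\<lambda>x. (?u x + v x) * divergence w x) \<in> borel_measurable (lebesgue_on \<Omega>)"
        "(\<lambda>x. ?u x * divergence w x) \<in> borel_measurable (lebesgue_on \<Omega>)"
        using m by measurable
      show "AE x in lebesgue_on \<Omega>. ?u x * divergence w x = (?u x + v x) * divergence w x"
        using K(3) div_w by (auto elim!: eventually_mono)
    qed
    finally have "ereal (\<integral>x. ?u x * divergence z x \<partial>lebesgue_on \<Omega>)
        \<le> ereal (\<integral>x. (?u x + v x) * divergence w x \<partial>lebesgue_on \<Omega>)" by simp
    also have "\<dots> \<le> phi_variation \<Omega> \<phi> (\<lambda>x. ?u x + v x)"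
      unfolding phi_variation_def
    proof (rule SUP_upper, intro CollectI conjI w AE_I2)
      show "dual_integrand \<phi> (w x) \<le> 1" for x
        unfolding w_def by (rule calibration) (rule \<eta>(2,3))+
    qed
    finally show "ereal (\<integral>x. ?u x * divergence z x \<partial>lebesgue_on \<Omega>)
        \<le> phi_variation \<Omega> \<phi> (\<lambda>x. ?u x + v x)" .
  qed
qed

lemma approx_discontinuity_set_continuous:
  assumes "continuous_on UNIV u" "open \<Omega>"
  shows "approx_discontinuity_set \<Omega> u = {}"
  using approx_limit_continuous[OF assms] unfolding approx_discontinuity_set_def by blast

text \<open>The maximum of a coordinate over the compact unit ball is attained at some \<open>e\<close>; \<open>z\<^sub>0\<close> is that
  coordinate functional divided by its maximum.\<close>
lemma exists_dual_pair:
  assumes "metric_integrand \<phi>"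
  obtains e z\<^sub>0 :: plane where "z\<^sub>0 \<bullet> e = 1"
    "\<And>z. dual_integrand \<phi> z \<le> 1 \<Longrightarrow> - 1 \<le> z \<bullet> e"
    "\<And>t. 0 \<le> t \<Longrightarrow> t \<le> 1 \<Longrightarrow> dual_integrand \<phi> (t *\<^sub>R (- z\<^sub>0)) \<le> 1"
proof -
  let ?B = "integrand_ball \<phi>"
  have hom: "\<phi> (t *\<^sub>R \<xi>) = \<bar>t\<bar> * \<phi> \<xi>" for t \<xi>
    using assms unfolding metric_integrand_def by blast
  obtain l \<Gamma> where l: "0 < l" "\<And>\<xi>. l * norm \<xi> \<le> \<phi> \<xi>" and \<Gamma>: "0 < \<Gamma>" "\<And>\<xi>. \<phi> \<xi> \<le> \<Gamma> * norm \<xi>"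
    using assms unfolding metric_integrand_def by metis
  have sym: "- \<xi> \<in> ?B" if "\<xi> \<in> ?B" for \<xi>
    using hom[of "- 1" \<xi>] that by (simp add: integrand_ball_def)
  have zero: "0 \<in> ?B" using hom[of 0 0] by (simp add: integrand_ball_def)
  have norm_le: "norm \<xi> \<le> 1 / l" if "\<xi> \<in> ?B" for \<xi>
  proof -
    have "l * norm \<xi> \<le> 1" using l(2)[of \<xi>] that by (simp add: integrand_ball_def)
    then show ?thesis using l(1) by (simp add: field_simps)
  qed
  have "continuous_on UNIV \<phi>"
    using assms unfolding metric_integrand_def by (intro convex_on_continuous) auto
  then have "closed ?B"
    unfolding integrand_ball_def by (intro closed_Collect_le continuous_intros)
  moreover have "bounded ?B" using norm_le by (auto simp: bounded_iff)
  ultimately have "compact ?B" by (simp add: compact_eq_bounded_closed)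
  obtain b :: plane where b: "b \<in> Basis" using nonempty_Basis by blast
  have cont: "continuous_on ?B (\<lambda>\<xi>. \<xi> \<bullet> b)" by (intro continuous_intros)
  obtain e where e: "e \<in> ?B" "\<And>\<xi>. \<xi> \<in> ?B \<Longrightarrow> \<xi> \<bullet> b \<le> e \<bullet> b"
    using continuous_attains_sup[OF \<open>compact ?B\<close> _ cont] zero by blast
  have "(1 / \<Gamma>) *\<^sub>R b \<in> ?B"
    using \<Gamma>(1) \<Gamma>(2)[of b] b by (simp add: integrand_ball_def hom divide_simps)
  from e(2)[OF this] have pos: "0 < e \<bullet> b"
    using b \<Gamma>(1) less_le_trans[of 0 "1 / \<Gamma>" "e \<bullet> b"] by (simp add: inner_same_Basis)
  define z\<^sub>0 where "z\<^sub>0 = (1 / (e \<bullet> b)) *\<^sub>R b"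
  have dual_set: "{z \<bullet> \<xi> |\<xi>. \<phi> \<xi> \<le> 1} = (\<lambda>\<xi>. z \<bullet> \<xi>) ` ?B" for z
    by (auto simp: integrand_ball_def)
  show ?thesis
  proof (rule that[of z\<^sub>0 e])
    show "z\<^sub>0 \<bullet> e = 1" using pos by (simp add: z\<^sub>0_def inner_commute)
    show "- 1 \<le> z \<bullet> e" if "dual_integrand \<phi> z \<le> 1" for z
    proof -
      have "z \<bullet> \<xi> \<le> norm z * (1 / l)" if "\<xi> \<in> ?B" for \<xi>
        by (rule order_trans[OF norm_cauchy_schwarz mult_left_mono[OF norm_le[OF that]]]) simp
      then have "bdd_above ((\<lambda>\<xi>. z \<bullet> \<xi>) ` ?B)" by (auto intro!: bdd_aboveI[of _ "norm z * (1 / l)"])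
      then have "z \<bullet> (- e) \<le> dual_integrand \<phi> z"
        unfolding dual_integrand_def dual_set by (intro cSup_upper imageI sym e(1))
      then show ?thesis using that by simp
    qed
    show "dual_integrand \<phi> (t *\<^sub>R (- z\<^sub>0)) \<le> 1" if t: "0 \<le> t" "t \<le> 1" for t
      unfolding dual_integrand_def dual_set
    proof (rule cSup_least)
      show "(\<lambda>\<xi>. (t *\<^sub>R (- z\<^sub>0)) \<bullet> \<xi>) ` ?B \<noteq> {}" using zero by blast
      fix y assume "y \<in> (\<lambda>\<xi>. (t *\<^sub>R (- z\<^sub>0)) \<bullet> \<xi>) ` ?B"
      then obtain \<xi> where \<xi>: "\<xi> \<in> ?B" "y = (t *\<^sub>R (- z\<^sub>0)) \<bullet> \<xi>" by blast
      have "z\<^sub>0 \<bullet> (- \<xi>) \<le> 1"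
        using e(2)[OF sym[OF \<xi>(1)]] pos by (simp add: z\<^sub>0_def field_simps inner_commute)
      then have "t * (z\<^sub>0 \<bullet> (- \<xi>)) \<le> t * 1" using t(1) by (rule mult_left_mono)
      then show "y \<le> 1" using t(2) by (simp add: \<xi>(2))
    qed
  qed
qed

section \<open>Neither a Sobolev function nor a special function of bounded variation\<close>

lemma cantor_ridge_derivative_lebesgue_on:
  assumes "open \<Omega>" "\<psi> \<in> Cc1 \<Omega>"
  shows "(\<integral>x. cantor_ridge a e x * derivative_at \<psi> x v \<partial>lebesgue_on \<Omega>)
       = (\<integral>x. cantor_ridge a e x * derivative_at \<psi> x v \<partial>lborel)"
proof (rule integral_lebesgue_on_eq[OF assms(1)])
  show "(\<lambda>x. cantor_ridge a e x * derivative_at \<psi> x v) \<in> borel_measurable borel"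
    by (intro borel_measurable_continuous_onI continuous_intros continuous_cantor_ridge
        Cc1_continuous_derivative[OF assms(2)])
  obtain K where "K \<subseteq> \<Omega>" "\<And>x v. x \<notin> K \<Longrightarrow> derivative_at \<psi> x v = 0"
    using Cc1_support[OF assms(2)] by metis
  then show "cantor_ridge a e x * derivative_at \<psi> x v = 0" if "x \<notin> \<Omega>" for x
    using that by auto
qed

lemma cantor_ridge_not_W11:
  assumes "open \<Omega>" "a \<in> \<Omega>" "e \<noteq> 0"
  shows "cantor_ridge a e \<notin> W11 \<Omega>"
proof
  assume "cantor_ridge a e \<in> W11 \<Omega>"
  then obtain g :: "plane \<Rightarrow> plane" where g: "integrable (lebesgue_on \<Omega>) g"
    "\<And>\<psi> b. \<psi> \<in> Cc1 \<Omega> \<Longrightarrow> b \<in> Basis \<Longrightarrow>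
      (\<integral>x. cantor_ridge a e x * derivative_at \<psi> x b \<partial>lebesgue_on \<Omega>)
        = - (\<integral>x. (g x \<bullet> b) * \<psi> x \<partial>lebesgue_on \<Omega>)"
    unfolding W11_def by blast
  obtain b where b: "b \<in> Basis" "b \<bullet> e \<noteq> 0"
    using assms(3) euclidean_all_zero_iff[of e] by (auto simp: inner_commute)
  show False
  proof (rule cantor_ridge_not_absolutely_continuous[OF assms(1,2) b(2)])
    show "AE x in lebesgue_on \<Omega>. P x" if "AE x in lborel. P x" for P
      using AE_completion[OF that] assms(1) by (subst AE_restrict_space_iff) (auto elim!: eventually_mono)
    show "h \<in> borel_measurable (lebesgue_on \<Omega>)" if "h \<in> borel_measurable borel" for h :: "plane \<Rightarrow> real"
      using that by (intro measurable_restrict_space1 measurable_completion) simp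
    show "integrable (lebesgue_on \<Omega>) (\<lambda>x. g x \<bullet> b)" using g(1) by simp
    show "(\<integral>x. cantor_ridge a e x * derivative_at \<psi> x b \<partial>lborel)
        = - (\<integral>x. \<psi> x * (g x \<bullet> b) \<partial>lebesgue_on \<Omega>)" if "\<psi> \<in> Cc1 \<Omega>" for \<psi>
      using g(2)[OF that b(1)] cantor_ridge_derivative_lebesgue_on[OF assms(1) that]
      by (simp add: mult.commute)
  qed
qed

text \<open>A vanishing Cantor part forces \<open>\<sigma> = 0\<close> almost everywhere on the singular carrier \<open>N\<close>; as \<open>\<sigma>\<close> is a
  unit field, \<open>N\<close> is negligible for \<open>\<mu>\<close>, which is then absolutely continuous.\<close>
lemma cantor_ridge_not_SBV:
  assumes "open \<Omega>" "a \<in> \<Omega>" "e \<noteq> 0"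
  shows "cantor_ridge a e \<notin> SBV \<Omega>"
proof
  assume "cantor_ridge a e \<in> SBV \<Omega>"
  then obtain \<mu> \<sigma> N where der: "BV_derivative \<Omega> (cantor_ridge a e) \<mu> \<sigma>" and sing: "singular_carrier \<mu> N"
    and cantor: "\<And>B. B \<in> sets borel \<Longrightarrow> cantor_part \<Omega> (cantor_ridge a e) \<mu> \<sigma> N B = 0"
    unfolding SBV_def mem_Collect_eq by (elim conjE exE) (rule that, assumption+, rule bspec)
  have sets [measurable_cong, simp]: "sets \<mu> = sets borel" and "finite_measure \<mu>"
    and out: "emeasure \<mu> (- \<Omega>) = 0" and \<sigma> [measurable]: "\<sigma> \<in> borel_measurable borel"
    and unit: "AE x in \<mu>. norm (\<sigma> x) = 1"
    and rep: "\<forall>z \<in> Cc1 \<Omega>. (\<integral>x. cantor_ridge a e x * divergence z x \<partial>lebesgue_on \<Omega>)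
      = - (\<integral>x. z x \<bullet> \<sigma> x \<partial>\<mu>)"
    using der unfolding BV_derivative_def by - (elim conjE, assumption)+
  interpret finite_measure \<mu> by fact
  have space: "space \<mu> = UNIV" using sets_eq_imp_space_eq[OF sets] by simp
  have N [measurable]: "N \<in> sets borel" "emeasure lborel N = 0"
    using sing unfolding singular_carrier_def by auto
  have \<Omega> [measurable]: "\<Omega> \<in> sets borel" using assms(1) by simp
  have int: "integrable \<mu> \<sigma>"
    using unit by (intro integrable_const_bound[where B = 1]) auto
  \<comment> \<open>A continuous function has no approximate discontinuities, so that the Cantor part is the
    whole singular part.\<close>
  have part: "(LINT x : B \<inter> N \<inter> \<Omega> | \<mu>. \<sigma> x) = 0" if "B \<in> sets borel" for B
    using cantor[OF that]
    by (simp add: cantor_part_def approx_discontinuity_set_continuous[OF continuous_cantor_ridge assms(1)])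
  have "AE x in \<mu>. indicator (N \<inter> \<Omega>) x *\<^sub>R \<sigma> x = 0"
  proof (rule density_zero)
    show "integrable \<mu> (\<lambda>x. indicator (N \<inter> \<Omega>) x *\<^sub>R \<sigma> x)"
      by (intro integrable_mult_indicator int) simp
    show "set_lebesgue_integral \<mu> A (\<lambda>x. indicator (N \<inter> \<Omega>) x *\<^sub>R \<sigma> x) = 0" if "A \<in> sets \<mu>" for A
      using part[of A] that by (simp add: set_lebesgue_integral_def indicator_inter_arith Int_assoc)
  qed
  moreover have "AE x in \<mu>. x \<in> \<Omega>"
    using out by (intro AE_I[of _ _ "- \<Omega>"]) auto
  ultimately have off_N: "AE x in \<mu>. x \<notin> N"
    using unit by eventually_elim (auto simp: indicator_def split: if_splits)
  have ac: "AE x in \<mu>. P x" if P: "AE x in lborel. P x" for P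
  proof -
    obtain A where A: "A \<in> null_sets lborel" "{x. \<not> P x} \<subseteq> A"
      using P by (auto simp: eventually_ae_filter)
    have "A \<in> null_sets (density \<mu> (indicator (- N)))"
      using sing A(1) unfolding singular_carrier_def absolutely_continuous_def by blast
    then have "AE x in \<mu>. x \<in> A \<longrightarrow> indicator (- N) x = (0 :: ennreal)"
      by (subst (asm) null_sets_density_iff) auto
    with off_N show ?thesis
      by eventually_elim (use A(2) in \<open>auto simp: indicator_def\<close>)
  qed
  obtain b where b: "b \<in> Basis" "b \<bullet> e \<noteq> 0"
    using assms(3) euclidean_all_zero_iff[of e] by (auto simp: inner_commute)
  show False
  proof (rule cantor_ridge_not_absolutely_continuous[OF assms(1,2) b(2) ac])
    show "h \<in> borel_measurable \<mu>" if "h \<in> borel_measurable borel" for h :: "plane \<Rightarrow> real"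
      using that by measurable
    show "integrable \<mu> (\<lambda>x. \<sigma> x \<bullet> b)" using int by simp
    show "(\<integral>x. cantor_ridge a e x * derivative_at \<psi> x b \<partial>lborel) = - (\<integral>x. \<psi> x * (\<sigma> x \<bullet> b) \<partial>\<mu>)"
      if \<psi>: "\<psi> \<in> Cc1 \<Omega>" for \<psi>
    proof -
      have "divergence (\<lambda>x. \<psi> x *\<^sub>R b) x = derivative_at \<psi> x b" for x
        by (simp add: divergence_def Cc1_scaleR_const(2)[OF \<psi>] inner_Basis b(1) if_distrib
            sum.delta cong: if_cong)
      then show ?thesis
        using bspec[OF rep Cc1_scaleR_const(1)[OF \<psi>, of b]] cantor_ridge_derivative_lebesgue_on[OF assms(1) \<psi>]
        by (simp add: inner_commute)
    qed
  qed
qed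

theorem proposition5p7:
  fixes \<Omega> :: "(real^2) set" and \<phi> :: "real^2 \<Rightarrow> real"
  assumes "open \<Omega>" and "bounded \<Omega>" and "convex \<Omega>" and "\<Omega> \<noteq> {}"
    and "metric_integrand \<phi>"
    and "\<not> strictly_convex_ball \<phi>"
  shows "\<exists>f :: real^2 \<Rightarrow> real. continuous_on (frontier \<Omega>) f \<and>
           (\<exists>u\<^sub>1 u\<^sub>2. least_gradient_solution \<Omega> \<phi> f u\<^sub>1 \<and> least_gradient_solution \<Omega> \<phi> f u\<^sub>2 \<and>
              u\<^sub>1 \<notin> W11 \<Omega> \<and> u\<^sub>2 \<notin> SBV \<Omega>)"
proof -
  obtain a where a: "a \<in> \<Omega>" using assms(4) by blast
  obtain e z\<^sub>0 :: plane where e: "z\<^sub>0 \<bullet> e = 1"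
    "\<And>z. dual_integrand \<phi> z \<le> 1 \<Longrightarrow> - 1 \<le> z \<bullet> e"
    "\<And>t. 0 \<le> t \<Longrightarrow> t \<le> 1 \<Longrightarrow> dual_integrand \<phi> (t *\<^sub>R (- z\<^sub>0)) \<le> 1"
    by (rule exists_dual_pair[OF assms(5)]) blast
  then have "e \<noteq> 0" by auto
  let ?u = "cantor_ridge a e"
  have "least_gradient_solution \<Omega> \<phi> ?u ?u"
    unfolding least_gradient_solution_def
    using cantor_ridge_least_gradient[OF assms(1,2) e] has_trace_continuous[OF continuous_cantor_ridge assms(1)]
    by blast
  moreover have "?u \<notin> W11 \<Omega>" "?u \<notin> SBV \<Omega>"
    using cantor_ridge_not_W11 cantor_ridge_not_SBV assms(1) a \<open>e \<noteq> 0\<close> by auto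
  ultimately show ?thesis
    by (intro exI[of _ ?u] conjI continuous_cantor_ridge)
qed

end
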